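(* Let $M=G/H$ be a homogeneous space endowed with a $G$-invariant Riemannian metric and a solid homogeneous cone field $C_M$. Suppose that the conal order $\leq_M$ is quasi-closed and that the chronological sets $I^+$ and $I^-$ are continuous. Let $\varphi_t$ be the flow of a continuously differentiable vector field on $M$ which is strongly differentially positive with respect to $C_M$ and such that each orbit is well-defined for all $t\ge 0$ and has compact closure. If $x\in\mathcal{R}(\varphi)$ and there is some $T>0$ such that either $x<_M\varphi_T(x)$ or $\varphi_T(x)<_M x$, then $\omega(x)$ is ordered; furthermore, for any $y_1,y_2\in\omega(x)$, both $y_1\leq_M y_2$ and $y_2\leq_M y_1$ hold.
   Context: Setting: $G$ is a connected Lie group endowed with a left-invariant Riemannian metric, $H$ a closed subgroup, $M=G/H$ with its smooth transitive left action $(g,x)\mapsto g\cdot x$, and $\lambda_g(x)=g\cdot x$. A Riemannian metric on $M$ is $G$-invariant if every $\lambda_g$ is an isometry. Cone fields: a closed convex cone in a finite-dimensional real vector space is a nonempty closed subset $C$ with $C+C\subset C$, $\alpha C\subset C$ for all $\alpha\ge 0$, and $C\cap(-C)=\{0\}$; it is solid if $\mathrm{Int}\,C\neq\emptyset$. A cone field $C_M$ on $M$ assigns to each $x\in M$ a closed convex cone $C_M(x)\subset T_xM$; it is solid if every $C_M(x)$ is solid, and homogeneous if $d\lambda_g|_x(C_M(x))=C_M(g\cdot x)$ for all $g\in G$, $x\in M$. Orders: a conal curve is a continuous, piecewise continuously differentiable curve $\gamma:[t_0,t_1]\to M$, $t_0<t_1$, with $\gamma'(t)\in C_M(\gamma(t))$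 for $t_0\le t<t_1$ (right-hand derivative at the finitely many points where the derivative is not continuous); it is strictly conal if moreover $\gamma'(t)\in\mathrm{Int}\,C_M(\gamma(t))$ for $t_0\le t<t_1$. Write $x\leq_M y$ if there is a conal curve from $x$ to $y$ (the conal order; reflexive and transitive, not necessarily antisymmetric), $x<_M y$ if $x\leq_M y$ and $x\ne y$, and $x\ll_M y$ if there is a strictly conal curve from $x$ to $y$. A set is ordered if for any $x,y$ in it $x\leq_M y$ or $y\leq_M x$. The order $\leq_M$ is quasi-closed if $x\leq_M y$ whenever $x_n\to x$, $y_n\to y$ and $x_n\ll_M y_n$ for all $n$. Chronological sets: $I^+(p)=\{q: p\ll_M q\}$, $I^-(p)=\{q: q\ll_M p\}$. $I^{+}$ is inner continuous at $p$ if for each compact $K\subset I^{+}(p)$ there is a neighborhood $U$ of $p$ with $K\subset I^{+}(q)$ for all $q\in U$; outer continuous at $p$ if for each compact $K\subset M\setminus\overline{I^{+}(p)}$ there is a neighborhood $U$ of $p$ with $K\subset M\setminus\overline{I^{+}(q)}$ for all $q\in U$; continuous if it is inner and outer continuous at every $p\in M$. Likewise for $I^-$. Dynamics: the flow $\varphi:\mathbb{R}\times M\to M$ is strongly differentially positive with respect to $C_M$ if $d\varphi_t(x)\{C_M(x)\setminus\{0\}\}\subseteq \mathrm{Int}\,C_M(\varphi_t(x))$ for all $x\in M$, $t>0$. The orbit of $x$ is $O(x)=\{\varphi_t(x):t\in\mathbb{R}\}$, $\omega(x)=\bigcap_{s\ge0}\overline{\bigcup_{t\ge s}\varphi_t(x)}$,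 and $\mathcal{R}(\varphi)=\{x\in M: x\in\omega(x)\}$ is the set of recurrent points. *)

theory Defs
  imports "HOL-Analysis.Analysis" "HOL-Algebra.Left_Coset"
begin

section \<open>Smooth manifolds\<close>

text \<open>A chart is a domain together with a coordinate function, only the values of which on the
  domain matter. A manifold carries an atlas that need not be maximal.\<close>

type_synonym ('a, 'e) chart = "'a set \<times> ('a \<Rightarrow> 'e)"

record ('a, 'e) manifold =
  mtop :: "'a topology"
  atlas :: "('a, 'e) chart set"

definition chart_inv :: "('a, 'e) chart \<Rightarrow> 'e \<Rightarrow> 'a" where
  "chart_inv \<kappa> = inv_into (fst \<kappa>) (snd \<kappa>)"

definition charts_at :: "('a, 'e) manifold \<Rightarrow> 'a \<Rightarrow> ('a, 'e) chart set" where
  "charts_at M x = {\<kappa> \<in> atlas M. x \<in> fst \<kappa>}"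

definition is_chart :: "'a topology \<Rightarrow> ('a, 'e::euclidean_space) chart \<Rightarrow> bool" where
  "is_chart X \<kappa> \<longleftrightarrow> openin X (fst \<kappa>) \<and> open (snd \<kappa> ` fst \<kappa>) \<and>
     homeomorphic_map (subtopology X (fst \<kappa>)) (top_of_set (snd \<kappa> ` fst \<kappa>)) (snd \<kappa>)"

text \<open>Functions of class \<open>C\<^sup>k\<close> on an open set \<open>S\<close>; in finite dimension, a derivative is of
  class \<open>C\<^sup>k\<close> iff all its directional components are.\<close>

primrec Ck_on :: "nat \<Rightarrow> ('a::euclidean_space \<Rightarrow> 'b::real_normed_vector) \<Rightarrow> 'a set \<Rightarrow> bool" where
  "Ck_on 0 f S \<longleftrightarrow> continuous_on S f"
| "Ck_on (Suc k) f S \<longleftrightarrow>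
     (\<exists>f'. (\<forall>x\<in>S. (f has_derivative f' x) (at x)) \<and> (\<forall>v. Ck_on k (\<lambda>x. f' x v) S))"

definition smooth_on :: "('a::euclidean_space \<Rightarrow> 'b::real_normed_vector) \<Rightarrow> 'a set \<Rightarrow> bool" where
  "smooth_on f S \<longleftrightarrow> (\<forall>k. Ck_on k f S)"

definition smooth_manifold :: "('a, 'e::euclidean_space) manifold \<Rightarrow> bool" where
  "smooth_manifold M \<longleftrightarrow>
     Hausdorff_space (mtop M) \<and> second_countable (mtop M) \<and>
     (\<forall>\<kappa>\<in>atlas M. is_chart (mtop M) \<kappa>) \<and>
     (\<Union>\<kappa>\<in>atlas M. fst \<kappa>) = topspace (mtop M) \<and>
     (\<forall>\<kappa>\<in>atlas M. \<forall>\<kappa>'\<in>atlas M.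
        smooth_on (snd \<kappa>' \<circ> chart_inv \<kappa>) (snd \<kappa> ` (fst \<kappa> \<inter> fst \<kappa>')))"

definition prod_manifold ::
    "('a, 'e::euclidean_space) manifold \<Rightarrow> ('b, 'f::euclidean_space) manifold \<Rightarrow>
     ('a \<times> 'b, 'e \<times> 'f) manifold" where
  "prod_manifold M N =
     \<lparr>mtop = prod_topology (mtop M) (mtop N),
      atlas = {(fst \<kappa> \<times> fst \<kappa>', \<lambda>(x, y). (snd \<kappa> x, snd \<kappa>' y)) |\<kappa> \<kappa>'.
                 \<kappa> \<in> atlas M \<and> \<kappa>' \<in> atlas N}\<rparr>"

definition real_manifold :: "(real, real) manifold" where
  "real_manifold = \<lparr>mtop = euclidean, atlas = {(UNIV, id)}\<rparr>"

definition Ck_map ::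
    "nat \<Rightarrow> ('a, 'e::euclidean_space) manifold \<Rightarrow> ('b, 'f::euclidean_space) manifold \<Rightarrow>
     ('a \<Rightarrow> 'b) \<Rightarrow> bool" where
  "Ck_map k M N f \<longleftrightarrow> continuous_map (mtop M) (mtop N) f \<and>
     (\<forall>\<kappa>\<in>atlas M. \<forall>\<kappa>'\<in>atlas N.
        Ck_on k (snd \<kappa>' \<circ> f \<circ> chart_inv \<kappa>) (snd \<kappa> ` {x \<in> fst \<kappa>. f x \<in> fst \<kappa>'}))"

definition smooth_map ::
    "('a, 'e::euclidean_space) manifold \<Rightarrow> ('b, 'f::euclidean_space) manifold \<Rightarrow>
     ('a \<Rightarrow> 'b) \<Rightarrow> bool" where
  "smooth_map M N f \<longleftrightarrow> (\<forall>k. Ck_map k M N f)"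


section \<open>Tangent vectors, differentials, vector fields and metrics\<close>

text \<open>A tangent vector at \<open>x\<close> is given by its coordinate vectors in all charts around \<open>x\<close>, related
  by the derivatives of the coordinate changes; the components at the other charts are zero.
  Addition and scaling are pointwise. As all components are linear isomorphic images of any
  single one, the canonical topology of the vector space \<open>T\<^sub>x M\<close> is the one induced by the product
  topology on the function space.\<close>

type_synonym ('a, 'e) tangent = "('a, 'e) chart \<Rightarrow> 'e"

definition tangent_space :: "('a, 'e::euclidean_space) manifold \<Rightarrow> 'a \<Rightarrow> ('a, 'e) tangent set" where
  "tangent_space M x = {v.
     (\<forall>\<kappa>. \<kappa> \<notin> charts_at M x \<longrightarrow> v \<kappa> = 0) \<and>
     (\<forall>\<kappa>\<in>charts_at M x. \<forall>\<kappa>'\<in>charts_at M x.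
        v \<kappa>' = frechet_derivative (snd \<kappa>' \<circ> chart_inv \<kappa>) (at (snd \<kappa> x)) (v \<kappa>))}"

text \<open>The tangent vector at \<open>x\<close> with coordinate vector \<open>e\<close> in the chart \<open>\<kappa>\<close> around \<open>x\<close>.\<close>

definition coord_vector ::
    "('a, 'e::euclidean_space) manifold \<Rightarrow> ('a, 'e) chart \<Rightarrow> 'a \<Rightarrow> 'e \<Rightarrow> ('a, 'e) tangent" where
  "coord_vector M \<kappa> x e = (\<lambda>\<kappa>'. if \<kappa>' \<in> charts_at M x
     then frechet_derivative (snd \<kappa>' \<circ> chart_inv \<kappa>) (at (snd \<kappa> x)) e else 0)"

text \<open>The differential of \<open>f\<close> at \<open>x\<close>, computed in some chart around \<open>x\<close>; by the chain rule the
  choice is irrelevant if \<open>f\<close> is differentiable at \<open>x\<close>.\<close>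

definition differential ::
    "('a, 'e::euclidean_space) manifold \<Rightarrow> ('b, 'f::euclidean_space) manifold \<Rightarrow> ('a \<Rightarrow> 'b) \<Rightarrow>
     'a \<Rightarrow> ('a, 'e) tangent \<Rightarrow> ('b, 'f) tangent" where
  "differential M N f x v =
     (let \<kappa> = (SOME \<kappa>. \<kappa> \<in> charts_at M x) in
      (\<lambda>\<kappa>'. if \<kappa>' \<in> charts_at N (f x)
         then frechet_derivative (snd \<kappa>' \<circ> f \<circ> chart_inv \<kappa>) (at (snd \<kappa> x)) (v \<kappa>) else 0))"

definition C1_vector_field ::
    "('a, 'e::euclidean_space) manifold \<Rightarrow> ('a \<Rightarrow> ('a, 'e) tangent) \<Rightarrow> bool" where
  "C1_vector_field M V \<longleftrightarrow>
     (\<forall>x\<in>topspace (mtop M). V x \<in> tangent_space M x) \<and>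
     (\<forall>\<kappa>\<in>atlas M. Ck_on 1 (\<lambda>u. V (chart_inv \<kappa> u) \<kappa>) (snd \<kappa> ` fst \<kappa>))"

type_synonym ('a, 'e) metric_tensor = "'a \<Rightarrow> ('a, 'e) tangent \<Rightarrow> ('a, 'e) tangent \<Rightarrow> real"

definition riemannian_metric ::
    "('a, 'e::euclidean_space) manifold \<Rightarrow> ('a, 'e) metric_tensor \<Rightarrow> bool" where
  "riemannian_metric M \<rho> \<longleftrightarrow>
     (\<forall>x\<in>topspace (mtop M).
        (\<forall>v\<in>tangent_space M x. \<forall>w\<in>tangent_space M x. \<rho> x v w = \<rho> x w v) \<and>
        (\<forall>u\<in>tangent_space M x. \<forall>v\<in>tangent_space M x. \<forall>w\<in>tangent_space M x. \<forall>a b.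
           \<rho> x (\<lambda>\<kappa>. a *\<^sub>R u \<kappa> + b *\<^sub>R v \<kappa>) w = a * \<rho> x u w + b * \<rho> x v w) \<and>
        (\<forall>v\<in>tangent_space M x. v \<noteq> (\<lambda>\<kappa>. 0) \<longrightarrow> \<rho> x v v > 0)) \<and>
     (\<forall>\<kappa>\<in>atlas M. \<forall>d e.
        smooth_on (\<lambda>u. let x = chart_inv \<kappa> u in
                        \<rho> x (coord_vector M \<kappa> x d) (coord_vector M \<kappa> x e))
                  (snd \<kappa> ` fst \<kappa>))"

definition riemannian_isometry ::
    "('a, 'e::euclidean_space) manifold \<Rightarrow> ('a, 'e) metric_tensor \<Rightarrow> ('a \<Rightarrow> 'a) \<Rightarrow> bool" where
  "riemannian_isometry M \<rho> f \<longleftrightarrow>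
     bij_betw f (topspace (mtop M)) (topspace (mtop M)) \<and>
     smooth_map M M f \<and> smooth_map M M (inv_into (topspace (mtop M)) f) \<and>
     (\<forall>x\<in>topspace (mtop M). \<forall>v\<in>tangent_space M x. \<forall>w\<in>tangent_space M x.
        \<rho> (f x) (differential M M f x v) (differential M M f x w) = \<rho> x v w)"


section \<open>Lie groups and homogeneous spaces\<close>

definition lie_group ::
    "('g, 'b) monoid_scheme \<Rightarrow> ('g, 'e::euclidean_space) manifold \<Rightarrow> bool" where
  "lie_group G L \<longleftrightarrow> group G \<and> smooth_manifold L \<and> topspace (mtop L) = carrier G \<and>
     smooth_map (prod_manifold L L) L (\<lambda>(a, b). a \<otimes>\<^bsub>G\<^esub> b) \<and>
     smooth_map L L (\<lambda>a. inv\<^bsub>G\<^esub> a)"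

definition left_invariant_metric ::
    "('g, 'b) monoid_scheme \<Rightarrow> ('g, 'e::euclidean_space) manifold \<Rightarrow> ('g, 'e) metric_tensor \<Rightarrow> bool"
  where
  "left_invariant_metric G L \<rho> \<longleftrightarrow> riemannian_metric L \<rho> \<and>
     (\<forall>a\<in>carrier G. riemannian_isometry L \<rho> (\<lambda>b. a \<otimes>\<^bsub>G\<^esub> b))"

text \<open>\<open>M\<close> is the quotient manifold \<open>G/H\<close>: its points are the left cosets of \<open>H\<close>, its topology is the
  quotient topology, and its smooth structure is the (unique) one for which the projection is a
  smooth submersion and \<open>G\<close> acts smoothly. The action \<open>g \<cdot> aH = gaH\<close> is the left translate
  of a subset of \<open>G\<close>.\<close>

definition homogeneous_space ::
    "('g, 'b) monoid_scheme \<Rightarrow> ('g, 'e::euclidean_space) manifold \<Rightarrow> 'g set \<Rightarrow>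
     ('g set, 'n::euclidean_space) manifold \<Rightarrow> bool" where
  "homogeneous_space G L H M \<longleftrightarrow>
     lie_group G L \<and> subgroup H G \<and> closedin (mtop L) H \<and>
     smooth_manifold M \<and> topspace (mtop M) = lcosets\<^bsub>G\<^esub> H \<and>
     quotient_map (mtop L) (mtop M) (\<lambda>a. a <#\<^bsub>G\<^esub> H) \<and>
     smooth_map L M (\<lambda>a. a <#\<^bsub>G\<^esub> H) \<and>
     (\<forall>a\<in>carrier G. differential L M (\<lambda>a. a <#\<^bsub>G\<^esub> H) a ` tangent_space L a =
                      tangent_space M (a <#\<^bsub>G\<^esub> H)) \<and>
     smooth_map (prod_manifold L M) M (\<lambda>(g, x). g <#\<^bsub>G\<^esub> x)"

definition invariant_metric ::
    "('g, 'b) monoid_scheme \<Rightarrow> ('g set, 'n::euclidean_space) manifold \<Rightarrow>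
     ('g set, 'n) metric_tensor \<Rightarrow> bool" where
  "invariant_metric G M \<rho> \<longleftrightarrow> riemannian_metric M \<rho> \<and>
     (\<forall>g\<in>carrier G. riemannian_isometry M \<rho> (\<lambda>x. g <#\<^bsub>G\<^esub> x))"


section \<open>Cone fields\<close>

definition closed_convex_cone :: "('a, 'e::euclidean_space) tangent set \<Rightarrow> ('a, 'e) tangent set \<Rightarrow> bool"
  where
  "closed_convex_cone T C \<longleftrightarrow> C \<noteq> {} \<and> closedin (top_of_set T) C \<and>
     (\<forall>v\<in>C. \<forall>w\<in>C. (\<lambda>\<kappa>. v \<kappa> + w \<kappa>) \<in> C) \<and>
     (\<forall>v\<in>C. \<forall>a::real. a \<ge> 0 \<longrightarrow> (\<lambda>\<kappa>. a *\<^sub>R v \<kappa>) \<in> C) \<and>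
     {v \<in> C. (\<lambda>\<kappa>. - v \<kappa>) \<in> C} = {\<lambda>\<kappa>. 0}"

type_synonym ('a, 'e) cone_field = "'a \<Rightarrow> ('a, 'e) tangent set"

definition is_cone_field ::
    "('a, 'e::euclidean_space) manifold \<Rightarrow> ('a, 'e) cone_field \<Rightarrow> bool" where
  "is_cone_field M C \<longleftrightarrow>
     (\<forall>x\<in>topspace (mtop M). closed_convex_cone (tangent_space M x) (C x))"

definition cone_interior ::
    "('a, 'e::euclidean_space) manifold \<Rightarrow> ('a, 'e) cone_field \<Rightarrow> 'a \<Rightarrow> ('a, 'e) tangent set" where
  "cone_interior M C x = top_of_set (tangent_space M x) interior_of (C x)"

definition solid_cone_field ::
    "('a, 'e::euclidean_space) manifold \<Rightarrow> ('a, 'e) cone_field \<Rightarrow> bool" where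
  "solid_cone_field M C \<longleftrightarrow>
     is_cone_field M C \<and> (\<forall>x\<in>topspace (mtop M). cone_interior M C x \<noteq> {})"

definition homogeneous_cone_field ::
    "('g, 'b) monoid_scheme \<Rightarrow> ('g set, 'n::euclidean_space) manifold \<Rightarrow>
     ('g set, 'n) cone_field \<Rightarrow> bool" where
  "homogeneous_cone_field G M C \<longleftrightarrow>
     (\<forall>g\<in>carrier G. \<forall>x\<in>topspace (mtop M).
        differential M M (\<lambda>y. g <#\<^bsub>G\<^esub> y) x ` C x = C (g <#\<^bsub>G\<^esub> x))"


section \<open>Conal curves and orders\<close>

text \<open>Curves that are \<open>C\<^sup>1\<close> on the closed interval \<open>[a, b]\<close>, with one-sided derivatives at the ends.\<close>

definition C1_curve_on ::
    "('a, 'e::euclidean_space) manifold \<Rightarrow> (real \<Rightarrow> 'a) \<Rightarrow> real \<Rightarrow> real \<Rightarrow> bool" where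
  "C1_curve_on M \<gamma> a b \<longleftrightarrow> (\<exists>v. \<forall>\<kappa>\<in>atlas M.
     (\<forall>t\<in>{a..b}. \<gamma> t \<in> fst \<kappa> \<longrightarrow>
        ((snd \<kappa> \<circ> \<gamma>) has_vector_derivative v t \<kappa>) (at t within {a..b})) \<and>
     continuous_on {t \<in> {a..b}. \<gamma> t \<in> fst \<kappa>} (\<lambda>t. v t \<kappa>))"

definition piecewise_C1_curve ::
    "('a, 'e::euclidean_space) manifold \<Rightarrow> (real \<Rightarrow> 'a) \<Rightarrow> real \<Rightarrow> real \<Rightarrow> bool" where
  "piecewise_C1_curve M \<gamma> t0 t1 \<longleftrightarrow>
     continuous_map (top_of_set {t0..t1}) (mtop M) \<gamma> \<and>
     (\<exists>P. finite P \<and> {t0, t1} \<subseteq> P \<and> P \<subseteq> {t0..t1} \<and>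
        (\<forall>a\<in>P. \<forall>b\<in>P. a < b \<and> {a<..<b} \<inter> P = {} \<longrightarrow> C1_curve_on M \<gamma> a b))"

text \<open>The right-hand derivative, which is the derivative wherever the latter exists.\<close>

definition curve_derivative ::
    "('a, 'e::euclidean_space) manifold \<Rightarrow> (real \<Rightarrow> 'a) \<Rightarrow> real \<Rightarrow> ('a, 'e) tangent" where
  "curve_derivative M \<gamma> t = (\<lambda>\<kappa>. if \<kappa> \<in> charts_at M (\<gamma> t)
     then vector_derivative (snd \<kappa> \<circ> \<gamma>) (at_right t) else 0)"

definition conal_curve ::
    "('a, 'e::euclidean_space) manifold \<Rightarrow> ('a, 'e) cone_field \<Rightarrow> (real \<Rightarrow> 'a) \<Rightarrow> real \<Rightarrow> real \<Rightarrow> bool"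
  where
  "conal_curve M C \<gamma> t0 t1 \<longleftrightarrow> t0 < t1 \<and> piecewise_C1_curve M \<gamma> t0 t1 \<and>
     (\<forall>t. t0 \<le> t \<and> t < t1 \<longrightarrow> curve_derivative M \<gamma> t \<in> C (\<gamma> t))"

definition strictly_conal_curve ::
    "('a, 'e::euclidean_space) manifold \<Rightarrow> ('a, 'e) cone_field \<Rightarrow> (real \<Rightarrow> 'a) \<Rightarrow> real \<Rightarrow> real \<Rightarrow> bool"
  where
  "strictly_conal_curve M C \<gamma> t0 t1 \<longleftrightarrow> conal_curve M C \<gamma> t0 t1 \<and>
     (\<forall>t. t0 \<le> t \<and> t < t1 \<longrightarrow> curve_derivative M \<gamma> t \<in> cone_interior M C (\<gamma> t))"

definition conal_le ::
    "('a, 'e::euclidean_space) manifold \<Rightarrow> ('a, 'e) cone_field \<Rightarrow> 'a \<Rightarrow> 'a \<Rightarrow> bool" where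
  "conal_le M C x y \<longleftrightarrow> (\<exists>\<gamma> t0 t1. conal_curve M C \<gamma> t0 t1 \<and> \<gamma> t0 = x \<and> \<gamma> t1 = y)"

definition conal_less ::
    "('a, 'e::euclidean_space) manifold \<Rightarrow> ('a, 'e) cone_field \<Rightarrow> 'a \<Rightarrow> 'a \<Rightarrow> bool" where
  "conal_less M C x y \<longleftrightarrow> conal_le M C x y \<and> x \<noteq> y"

definition conal_ll ::
    "('a, 'e::euclidean_space) manifold \<Rightarrow> ('a, 'e) cone_field \<Rightarrow> 'a \<Rightarrow> 'a \<Rightarrow> bool" where
  "conal_ll M C x y \<longleftrightarrow> (\<exists>\<gamma> t0 t1. strictly_conal_curve M C \<gamma> t0 t1 \<and> \<gamma> t0 = x \<and> \<gamma> t1 = y)"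

definition ordered_set ::
    "('a, 'e::euclidean_space) manifold \<Rightarrow> ('a, 'e) cone_field \<Rightarrow> 'a set \<Rightarrow> bool" where
  "ordered_set M C S \<longleftrightarrow> (\<forall>x\<in>S. \<forall>y\<in>S. conal_le M C x y \<or> conal_le M C y x)"

definition quasi_closed_order ::
    "('a, 'e::euclidean_space) manifold \<Rightarrow> ('a, 'e) cone_field \<Rightarrow> bool" where
  "quasi_closed_order M C \<longleftrightarrow> (\<forall>xs ys x y.
     limitin (mtop M) xs x sequentially \<and> limitin (mtop M) ys y sequentially \<and>
     (\<forall>n::nat. conal_ll M C (xs n) (ys n)) \<longrightarrow> conal_le M C x y)"

definition chron_future ::
    "('a, 'e::euclidean_space) manifold \<Rightarrow> ('a, 'e) cone_field \<Rightarrow> 'a \<Rightarrow> 'a set" where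
  "chron_future M C p = {q. conal_ll M C p q}"

definition chron_past ::
    "('a, 'e::euclidean_space) manifold \<Rightarrow> ('a, 'e) cone_field \<Rightarrow> 'a \<Rightarrow> 'a set" where
  "chron_past M C p = {q. conal_ll M C q p}"

definition inner_continuous_at :: "'a topology \<Rightarrow> ('a \<Rightarrow> 'a set) \<Rightarrow> 'a \<Rightarrow> bool" where
  "inner_continuous_at X I p \<longleftrightarrow> (\<forall>K. compactin X K \<and> K \<subseteq> I p \<longrightarrow>
     (\<exists>U. openin X U \<and> p \<in> U \<and> (\<forall>q\<in>U. K \<subseteq> I q)))"

definition outer_continuous_at :: "'a topology \<Rightarrow> ('a \<Rightarrow> 'a set) \<Rightarrow> 'a \<Rightarrow> bool" where
  "outer_continuous_at X I p \<longleftrightarrow>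
     (\<forall>K. compactin X K \<and> K \<subseteq> topspace X - X closure_of (I p) \<longrightarrow>
       (\<exists>U. openin X U \<and> p \<in> U \<and> (\<forall>q\<in>U. K \<subseteq> topspace X - X closure_of (I q))))"

definition continuous_set_map :: "'a topology \<Rightarrow> ('a \<Rightarrow> 'a set) \<Rightarrow> bool" where
  "continuous_set_map X I \<longleftrightarrow>
     (\<forall>p\<in>topspace X. inner_continuous_at X I p \<and> outer_continuous_at X I p)"


section \<open>Flows\<close>

text \<open>The flow of a \<open>C\<^sup>1\<close> vector field is the \<open>C\<^sup>1\<close> action of the additive group of the reals on \<open>M\<close>
  having the vector field as its infinitesimal generator. (A map whose trajectories are the
  integral curves of a \<open>C\<^sup>1\<close> field is automatically a \<open>C\<^sup>1\<close> action.)\<close>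

definition flow_of ::
    "('a, 'e::euclidean_space) manifold \<Rightarrow> ('a \<Rightarrow> ('a, 'e) tangent) \<Rightarrow> (real \<Rightarrow> 'a \<Rightarrow> 'a) \<Rightarrow> bool" where
  "flow_of M V \<phi> \<longleftrightarrow>
     Ck_map 1 (prod_manifold real_manifold M) M (\<lambda>(t, x). \<phi> t x) \<and>
     (\<forall>x\<in>topspace (mtop M).
        \<phi> 0 x = x \<and>
        (\<forall>s t. \<phi> (s + t) x = \<phi> s (\<phi> t x)) \<and>
        (\<forall>t. \<forall>\<kappa>\<in>charts_at M (\<phi> t x).
           ((\<lambda>s. snd \<kappa> (\<phi> s x)) has_vector_derivative V (\<phi> t x) \<kappa>) (at t)))"

definition strongly_differentially_positive ::
    "('a, 'e::euclidean_space) manifold \<Rightarrow> ('a, 'e) cone_field \<Rightarrow> (real \<Rightarrow> 'a \<Rightarrow> 'a) \<Rightarrow> bool" where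
  "strongly_differentially_positive M C \<phi> \<longleftrightarrow>
     (\<forall>x\<in>topspace (mtop M). \<forall>t>0.
        differential M M (\<phi> t) x ` (C x - {\<lambda>\<kappa>. 0}) \<subseteq> cone_interior M C (\<phi> t x))"

definition orbit_of :: "(real \<Rightarrow> 'a \<Rightarrow> 'a) \<Rightarrow> 'a \<Rightarrow> 'a set" where
  "orbit_of \<phi> x = range (\<lambda>t. \<phi> t x)"

definition omega_limit :: "'a topology \<Rightarrow> (real \<Rightarrow> 'a \<Rightarrow> 'a) \<Rightarrow> 'a \<Rightarrow> 'a set" where
  "omega_limit X \<phi> x = (\<Inter>s\<in>{0..}. X closure_of (\<Union>t\<in>{s..}. {\<phi> t x}))"

definition recurrent_points :: "'a topology \<Rightarrow> (real \<Rightarrow> 'a \<Rightarrow> 'a) \<Rightarrow> 'a set" where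
  "recurrent_points X \<phi> = {x \<in> topspace X. x \<in> omega_limit X \<phi> x}"

end

theory Submission
  imports Defs
begin

text \<open>
  Write \<open>y \<lless> z\<close> for \<^term>\<open>conal_ll M C y z\<close>. The flow turns a weak relation into a strict one:
  if \<open>\<gamma>\<close> is a conal curve and \<open>r > 0\<close>, then \<open>\<phi>\<^sub>r \<circ> \<gamma>\<close> is either constant or its endpoints are related
  by \<open>\<lless>\<close> (\<open>flow_conal_curve\<close>). Consequently \<open>x < \<phi>\<^sub>T x\<close> gives \<open>\<phi>\<^sub>1 x \<lless> \<phi>\<^bsub>1+T\<^esub> x\<close>. Inner continuity of
  \<open>I\<^sup>-\<close> makes this an open condition on the right-hand side, so \<open>\<phi>\<^sub>1 x \<lless> \<phi>\<^bsub>1+s\<^esub> x\<close> for all \<open>s\<close> in an open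
  interval around \<open>T\<close>; applying the flow again, \<open>\<phi>\<^sub>t x \<lless> \<phi>\<^bsub>t+s\<^esub> x\<close> for these \<open>s\<close> and all \<open>t \<ge> 1\<close>. The
  set of such \<open>s\<close> is closed under addition, and the multiples of an open interval of positive numbers
  cover a half-line, so \<open>\<phi>\<^sub>t x \<lless> \<phi>\<^bsub>t+s\<^esub> x\<close> holds for all \<open>t \<ge> 1\<close> and all sufficiently large \<open>s\<close>
  (\<open>related_for_late_times\<close>). Two points \<open>y\<^sub>1, y\<^sub>2\<close> of \<open>\<omega>(x)\<close> are limits of \<open>\<phi> (a n) x\<close> and \<open>\<phi> (b n) x\<close> where the
  gaps \<open>b n - a n\<close> can be chosen as large as desired, so quasi-closedness gives \<open>y\<^sub>1 \<le> y\<^sub>2\<close>; the roles of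
  \<open>y\<^sub>1\<close> and \<open>y\<^sub>2\<close> are interchangeable. The case \<open>\<phi>\<^sub>T x < x\<close> is the same with \<open>\<lless>\<close> reversed.

  The geometric content is \<open>flow_conal_curve\<close>. The curve \<open>\<phi>\<^sub>r \<circ> \<gamma>\<close> itself need not be strictly conal,
  because its derivative vanishes wherever that of \<open>\<gamma>\<close> does, possibly on a Cantor set. Locally it is
  replaced by a straight segment in a chart. Homogeneity makes the cones vary continuously
  (\<open>coord_cone_continuity\<close>), and compactness of the unit sphere then shows that near any point the
  nonzero derivatives of \<open>\<phi>\<^sub>r \<circ> \<gamma>\<close> lie in the interior of the cones at \<^emph>\<open>all\<close> nearby points
  (\<open>strict_positivity_uniform\<close>). By a separating hyperplane the increment of the curve over a
  short interval is zero or lies in the same open convex cones (\<open>increment_in_convex_cone\<close>), so in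
  the latter case the segment between the endpoints is strictly conal. A bisection argument
  joins the local statements.
\<close>

section \<open>Charts and tangent coordinates\<close>

lemma has_derivative_frechet:
  "(f has_derivative f') (at x) \<Longrightarrow> (f has_derivative frechet_derivative f (at x)) (at x)"
  using frechet_derivative_at by metis

lemma openin_preimage_on_open:
  assumes W: "openin X W" and f: "continuous_map (subtopology X W) Y f" and T: "openin Y T"
  shows "openin X {z \<in> W. f z \<in> T}"
proof -
  have "openin (subtopology X W) {z \<in> topspace (subtopology X W). f z \<in> T}"
    using openin_continuous_map_preimage[OF f T] .
  moreover have "topspace (subtopology X W) = W"
    using openin_subset[OF W] by auto
  ultimately have "openin (subtopology X W) {z \<in> W. f z \<in> T}"
    by (simp only:)
  then show ?thesis
    using openin_open_subtopology[OF W] by blast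
qed

definition trans_deriv :: "('a, 'e::euclidean_space) chart \<Rightarrow> ('a, 'e) chart \<Rightarrow> 'a \<Rightarrow> 'e \<Rightarrow> 'e" where
  "trans_deriv \<kappa> \<kappa>' p = frechet_derivative (snd \<kappa>' \<circ> chart_inv \<kappa>) (at (snd \<kappa> p))"

locale smooth_mfd =
  fixes M :: "('a, 'e::euclidean_space) manifold"
  assumes smooth: "smooth_manifold M"
begin

lemma chart:
  assumes "\<kappa> \<in> atlas M"
  shows "openin (mtop M) (fst \<kappa>)" "open (snd \<kappa> ` fst \<kappa>)"
    "homeomorphic_map (subtopology (mtop M) (fst \<kappa>)) (top_of_set (snd \<kappa> ` fst \<kappa>)) (snd \<kappa>)"
  using smooth assms by (auto simp: smooth_manifold_def is_chart_def)

lemma chart_subset: "\<kappa> \<in> atlas M \<Longrightarrow> fst \<kappa> \<subseteq> topspace (mtop M)"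
  using chart(1) openin_subset by blast

lemma chart_inj: "\<kappa> \<in> atlas M \<Longrightarrow> inj_on (snd \<kappa>) (fst \<kappa>)"
  using homeomorphic_imp_injective_map[OF chart(3)] chart_subset
  by (metis inf.absorb_iff2 topspace_subtopology)

lemma chart_inv_left [simp]:
  "\<kappa> \<in> atlas M \<Longrightarrow> y \<in> fst \<kappa> \<Longrightarrow> chart_inv \<kappa> (snd \<kappa> y) = y"
  by (simp add: chart_inv_def chart_inj)

lemma chart_inv_right [simp]:
  "u \<in> snd \<kappa> ` fst \<kappa> \<Longrightarrow> snd \<kappa> (chart_inv \<kappa> u) = u"
  by (simp add: chart_inv_def f_inv_into_f)

lemma chart_inv_mem [simp]:
  "u \<in> snd \<kappa> ` fst \<kappa> \<Longrightarrow> chart_inv \<kappa> u \<in> fst \<kappa>"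
  by (simp add: chart_inv_def inv_into_into)

lemma continuous_map_chart:
  assumes "\<kappa> \<in> atlas M"
  shows "continuous_map (subtopology (mtop M) (fst \<kappa>)) euclidean (snd \<kappa>)"
  using homeomorphic_imp_continuous_map[OF chart(3)[OF assms]] continuous_map_in_subtopology
  by blast

lemma continuous_map_chart_inv:
  assumes "\<kappa> \<in> atlas M"
  shows "continuous_map (top_of_set (snd \<kappa> ` fst \<kappa>)) (mtop M) (chart_inv \<kappa>)"
proof -
  obtain g where g: "homeomorphic_maps (subtopology (mtop M) (fst \<kappa>))
      (top_of_set (snd \<kappa> ` fst \<kappa>)) (snd \<kappa>) g"
    using chart(3)[OF assms] homeomorphic_map_maps by blast
  have "chart_inv \<kappa> u = g u" if "u \<in> snd \<kappa> ` fst \<kappa>" for u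
  proof -
    have "g (snd \<kappa> y) = y" if "y \<in> fst \<kappa>" for y
      using g that chart_subset[OF assms] by (auto simp: homeomorphic_maps_def)
    then show ?thesis using that assms by auto
  qed
  moreover have "continuous_map (top_of_set (snd \<kappa> ` fst \<kappa>)) (mtop M) g"
    using g by (auto simp: homeomorphic_maps_def continuous_map_in_subtopology)
  ultimately show ?thesis
    by (auto intro: continuous_map_eq)
qed

lemma openin_chart_preimage:
  assumes "\<kappa> \<in> atlas M" "open S"
  shows "openin (mtop M) {y \<in> fst \<kappa>. snd \<kappa> y \<in> S}"
  using openin_preimage_on_open[OF chart(1) continuous_map_chart] assms by simp

lemma open_chart_image:
  assumes "\<kappa> \<in> atlas M" "openin (mtop M) W" "W \<subseteq> fst \<kappa>"
  shows "open (snd \<kappa> ` W)"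
proof -
  have "openin (top_of_set (snd \<kappa> ` fst \<kappa>)) {u \<in> snd \<kappa> ` fst \<kappa>. chart_inv \<kappa> u \<in> W}"
    using openin_continuous_map_preimage[OF continuous_map_chart_inv[OF assms(1)] assms(2)] by simp
  moreover have "{u \<in> snd \<kappa> ` fst \<kappa>. chart_inv \<kappa> u \<in> W} = snd \<kappa> ` W"
    using assms(1,3) by force
  ultimately show ?thesis
    using chart(2)[OF assms(1)] openin_open_eq by metis
qed

lemma ex_chart: "p \<in> topspace (mtop M) \<Longrightarrow> \<exists>\<kappa>. \<kappa> \<in> charts_at M p"
  using smooth by (force simp: smooth_manifold_def charts_at_def)

lemma charts_atD:
  "\<kappa> \<in> charts_at M p \<Longrightarrow> \<kappa> \<in> atlas M" "\<kappa> \<in> charts_at M p \<Longrightarrow> p \<in> fst \<kappa>"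
  by (auto simp: charts_at_def)

lemma transition_C1:
  assumes "\<kappa> \<in> atlas M" "\<kappa>' \<in> atlas M"
  obtains f' where
    "\<And>u. u \<in> snd \<kappa> ` (fst \<kappa> \<inter> fst \<kappa>') \<Longrightarrow> ((snd \<kappa>' \<circ> chart_inv \<kappa>) has_derivative f' u) (at u)"
    "\<And>v. continuous_on (snd \<kappa> ` (fst \<kappa> \<inter> fst \<kappa>')) (\<lambda>u. f' u v)"
proof -
  have "Ck_on (Suc 0) (snd \<kappa>' \<circ> chart_inv \<kappa>) (snd \<kappa> ` (fst \<kappa> \<inter> fst \<kappa>'))"
    using smooth assms unfolding smooth_manifold_def smooth_on_def by blast
  then show thesis using that by auto
qed

lemma trans_deriv:
  assumes "\<kappa> \<in> charts_at M p" "\<kappa>' \<in> charts_at M p"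
  shows "((snd \<kappa>' \<circ> chart_inv \<kappa>) has_derivative trans_deriv \<kappa> \<kappa>' p) (at (snd \<kappa> p))"
  unfolding trans_deriv_def using assms
  by (metis (no_types, lifting) IntI charts_atD has_derivative_frechet image_eqI transition_C1)

lemma eventually_in_chart:
  assumes "\<kappa> \<in> charts_at M p"
  shows "eventually (\<lambda>u. u \<in> snd \<kappa> ` fst \<kappa>) (at (snd \<kappa> p))"
  using chart(2) assms charts_atD by (metis eventually_at_topological image_eqI)

lemma eventually_chart_nbhd:
  assumes "\<kappa> \<in> charts_at M p" "openin (mtop M) W" "p \<in> W"
  shows "eventually (\<lambda>u. u \<in> snd \<kappa> ` fst \<kappa> \<and> chart_inv \<kappa> u \<in> W) (at (snd \<kappa> p))"
proof -
  have "open (snd \<kappa> ` (W \<inter> fst \<kappa>))"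
    using assms charts_atD chart(1) open_chart_image by (metis Int_lower2 openin_Int)
  then have "eventually (\<lambda>u. u \<in> snd \<kappa> ` (W \<inter> fst \<kappa>)) (at (snd \<kappa> p))"
    using assms charts_atD by (metis IntI eventually_at_topological image_eqI)
  then show ?thesis
    by eventually_elim (use charts_atD(1)[OF assms(1)] in auto)
qed

text \<open>The cocycle identity of the coordinate changes, by the chain rule: it is what makes the
  coordinate vectors of \<^const>\<open>coord_vector\<close> compatible.\<close>

lemma trans_deriv_comp:
  assumes "\<kappa> \<in> charts_at M p" "\<kappa>' \<in> charts_at M p" "\<kappa>'' \<in> charts_at M p"
  shows "trans_deriv \<kappa>' \<kappa>'' p (trans_deriv \<kappa> \<kappa>' p v) = trans_deriv \<kappa> \<kappa>'' p v"
proof -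
  have p: "p \<in> fst \<kappa>" "p \<in> fst \<kappa>'" and at: "\<kappa> \<in> atlas M" "\<kappa>' \<in> atlas M"
    using assms charts_atD by auto
  have "((snd \<kappa>'' \<circ> chart_inv \<kappa>') has_derivative trans_deriv \<kappa>' \<kappa>'' p)
      (at ((snd \<kappa>' \<circ> chart_inv \<kappa>) (snd \<kappa> p)))"
    using trans_deriv[OF assms(2,3)] p at by simp
  from diff_chain_at[OF trans_deriv[OF assms(1,2)] this]
  have 1: "((snd \<kappa>'' \<circ> chart_inv \<kappa>') \<circ> (snd \<kappa>' \<circ> chart_inv \<kappa>) has_derivative
      trans_deriv \<kappa>' \<kappa>'' p \<circ> trans_deriv \<kappa> \<kappa>' p) (at (snd \<kappa> p))" .
  have "eventually (\<lambda>u. u \<in> snd \<kappa> ` fst \<kappa> \<and> chart_inv \<kappa> u \<in> fst \<kappa>') (at (snd \<kappa> p))"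
    using eventually_chart_nbhd[OF assms(1)] chart(1)[OF at(2)] p by blast
  then have ev: "eventually (\<lambda>u. ((snd \<kappa>'' \<circ> chart_inv \<kappa>') \<circ> (snd \<kappa>' \<circ> chart_inv \<kappa>)) u =
      (snd \<kappa>'' \<circ> chart_inv \<kappa>) u) (at (snd \<kappa> p))"
    by eventually_elim (use at in auto)
  have "((snd \<kappa>'' \<circ> chart_inv \<kappa>) has_derivative
      trans_deriv \<kappa>' \<kappa>'' p \<circ> trans_deriv \<kappa> \<kappa>' p) (at (snd \<kappa> p))"
    by (rule has_derivative_transform_eventually[OF 1 ev]) (use p at in auto)
  from has_derivative_unique[OF this trans_deriv[OF assms(1,3)]]
  show ?thesis by (metis comp_apply)
qed

lemma trans_deriv_refl:
  assumes "\<kappa> \<in> charts_at M p"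
  shows "trans_deriv \<kappa> \<kappa> p v = v"
proof -
  have ev: "eventually (\<lambda>u. u = (snd \<kappa> \<circ> chart_inv \<kappa>) u) (at (snd \<kappa> p))"
    using eventually_in_chart[OF assms] by eventually_elim simp
  have "((snd \<kappa> \<circ> chart_inv \<kappa>) has_derivative (\<lambda>v. v)) (at (snd \<kappa> p))"
    by (rule has_derivative_transform_eventually[OF has_derivative_ident ev])
      (use assms charts_atD in auto)
  from has_derivative_unique[OF this trans_deriv[OF assms assms]]
  show ?thesis by metis
qed

lemma linear_trans_deriv:
  "\<kappa> \<in> charts_at M p \<Longrightarrow> \<kappa>' \<in> charts_at M p \<Longrightarrow> linear (trans_deriv \<kappa> \<kappa>' p)"
  using trans_deriv has_derivative_linear by blast

lemma coord_vector_alt: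
  "coord_vector M \<kappa> p e = (\<lambda>\<kappa>'. if \<kappa>' \<in> charts_at M p then trans_deriv \<kappa> \<kappa>' p e else 0)"
  unfolding coord_vector_def trans_deriv_def ..

lemma tangent_space_trans:
  "v \<in> tangent_space M p \<Longrightarrow> \<kappa> \<in> charts_at M p \<Longrightarrow> \<kappa>' \<in> charts_at M p \<Longrightarrow>
    v \<kappa>' = trans_deriv \<kappa> \<kappa>' p (v \<kappa>)"
  unfolding tangent_space_def trans_deriv_def by blast

lemma tangent_space_outside:
  "v \<in> tangent_space M p \<Longrightarrow> \<kappa> \<notin> charts_at M p \<Longrightarrow> v \<kappa> = 0"
  unfolding tangent_space_def by blast

lemma coord_vector_tangent:
  "\<kappa> \<in> charts_at M p \<Longrightarrow> coord_vector M \<kappa> p e \<in> tangent_space M p"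
  unfolding tangent_space_def coord_vector_alt trans_deriv_def[symmetric]
  by (auto simp: trans_deriv_comp)

lemma coord_vector_coord [simp]:
  "\<kappa> \<in> charts_at M p \<Longrightarrow> coord_vector M \<kappa> p e \<kappa> = e"
  by (simp add: coord_vector_alt trans_deriv_refl)

lemma coord_vector_of_tangent:
  assumes "\<kappa> \<in> charts_at M p" "v \<in> tangent_space M p"
  shows "coord_vector M \<kappa> p (v \<kappa>) = v"
proof
  fix \<kappa>'
  show "coord_vector M \<kappa> p (v \<kappa>) \<kappa>' = v \<kappa>'"
    using tangent_space_trans[OF assms(2,1), of \<kappa>'] tangent_space_outside[OF assms(2), of \<kappa>']
    by (simp add: coord_vector_alt)
qed

lemma continuous_coord_vector:
  assumes "\<kappa> \<in> charts_at M p"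
  shows "continuous_on UNIV (coord_vector M \<kappa> p)"
  unfolding coord_vector_alt
  apply (rule continuous_on_coordinatewise_then_product)
  subgoal for \<kappa>'
    using linear_continuous_on[of "trans_deriv \<kappa> \<kappa>' p" UNIV] linear_trans_deriv[OF assms]
    by (cases "\<kappa>' \<in> charts_at M p") (auto simp: linear_conv_bounded_linear)
  done

end

section \<open>Cones in chart coordinates\<close>

text \<open>Reading all cones over a chart domain in the one model space makes cones at different points
  comparable.\<close>

definition coord_cone :: "('a, 'e::euclidean_space) cone_field \<Rightarrow> ('a, 'e) chart \<Rightarrow> 'a \<Rightarrow> 'e set" where
  "coord_cone C \<kappa> p = (\<lambda>v. v \<kappa>) ` C p"

locale cone_mfd = smooth_mfd M for M :: "('a, 'e::euclidean_space) manifold" +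
  fixes C :: "('a, 'e) cone_field"
  assumes cone_field: "is_cone_field M C"
begin

lemma cone_subset:
  assumes "p \<in> topspace (mtop M)"
  shows "C p \<subseteq> tangent_space M p"
proof -
  have "closedin (top_of_set (tangent_space M p)) (C p)"
    using cone_field assms unfolding is_cone_field_def closed_convex_cone_def by blast
  from closedin_subset[OF this] show ?thesis by simp
qed

lemma coord_cone_iff:
  assumes "\<kappa> \<in> charts_at M p"
  shows "e \<in> coord_cone C \<kappa> p \<longleftrightarrow> coord_vector M \<kappa> p e \<in> C p"
proof -
  have "p \<in> topspace (mtop M)" using assms charts_atD chart_subset by blast
  then have "coord_vector M \<kappa> p (v \<kappa>) \<in> C p" if "v \<in> C p" for v
    using coord_vector_of_tangent[OF assms subsetD[OF cone_subset that]] that by simp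
  moreover have "e \<in> (\<lambda>v. v \<kappa>) ` C p" if "coord_vector M \<kappa> p e \<in> C p"
    using imageI[OF that, of "\<lambda>v. v \<kappa>"] coord_vector_coord[OF assms] by simp
  ultimately show ?thesis
    unfolding coord_cone_def by auto
qed

lemma coord_cone_closed:
  assumes "\<kappa> \<in> charts_at M p"
  shows "closed (coord_cone C \<kappa> p)"
proof -
  have p: "p \<in> topspace (mtop M)" using assms charts_atD chart_subset by blast
  then have "closedin (top_of_set (tangent_space M p)) (C p)"
    using cone_field by (auto simp: is_cone_field_def closed_convex_cone_def)
  then obtain F where F: "closed F" "C p = tangent_space M p \<inter> F"
    by (auto simp: closedin_closed)
  have "coord_cone C \<kappa> p = coord_vector M \<kappa> p -` F"
    using coord_cone_iff[OF assms] coord_vector_tangent[OF assms] F by auto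
  then show ?thesis
    using F(1) continuous_coord_vector[OF assms] by (simp add: closed_vimage)
qed

lemma coord_cone_props:
  assumes "\<kappa> \<in> charts_at M p"
  shows coord_cone_add: "\<lbrakk>v \<in> coord_cone C \<kappa> p; w \<in> coord_cone C \<kappa> p\<rbrakk> \<Longrightarrow> v + w \<in> coord_cone C \<kappa> p"
    and coord_cone_scale: "\<lbrakk>v \<in> coord_cone C \<kappa> p; c \<ge> 0\<rbrakk> \<Longrightarrow> c *\<^sub>R v \<in> coord_cone C \<kappa> p"
    and coord_cone_pointed: "\<lbrakk>v \<in> coord_cone C \<kappa> p; - v \<in> coord_cone C \<kappa> p\<rbrakk> \<Longrightarrow> v = 0"
proof -
  have p: "p \<in> topspace (mtop M)" using assms charts_atD chart_subset by blast
  then have cc: "closed_convex_cone (tangent_space M p) (C p)"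
    using cone_field by (auto simp: is_cone_field_def)
  show "v + w \<in> coord_cone C \<kappa> p" if "v \<in> coord_cone C \<kappa> p" "w \<in> coord_cone C \<kappa> p" for v w
    using that cc unfolding coord_cone_def closed_convex_cone_def by (auto intro!: image_eqI)
  show "c *\<^sub>R v \<in> coord_cone C \<kappa> p" if "v \<in> coord_cone C \<kappa> p" "c \<ge> 0" for v c
    using that cc unfolding coord_cone_def closed_convex_cone_def by (auto intro!: image_eqI)
  show "v = 0" if "v \<in> coord_cone C \<kappa> p" "- v \<in> coord_cone C \<kappa> p" for v
  proof -
    let ?v = "coord_vector M \<kappa> p v"
    have "coord_vector M \<kappa> p (- v) = (\<lambda>\<kappa>'. - ?v \<kappa>')"
      using linear_trans_deriv[OF assms] by (auto simp: coord_vector_alt linear_neg)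
    then have "?v \<in> {v \<in> C p. (\<lambda>\<kappa>. - v \<kappa>) \<in> C p}"
      using that coord_cone_iff[OF assms] by auto
    then have "?v = (\<lambda>\<kappa>. 0)"
      using cc unfolding closed_convex_cone_def by auto
    then show ?thesis by (metis assms coord_vector_coord)
  qed
qed

lemma coord_cone_convex: "\<kappa> \<in> charts_at M p \<Longrightarrow> convex (coord_cone C \<kappa> p)"
  by (simp add: convex_def coord_cone_add coord_cone_scale)

text \<open>A chart identifies the tangent space with the model space by a linear homeomorphism, whose
  inverse is \<^const>\<open>coord_vector\<close>, so interiors may be computed in coordinates.\<close>

lemma coord_cone_interior_iff:
  assumes "\<kappa> \<in> charts_at M p"
  shows "e \<in> interior (coord_cone C \<kappa> p) \<longleftrightarrow> coord_vector M \<kappa> p e \<in> cone_interior M C p"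
proof
  have p: "p \<in> topspace (mtop M)" using assms charts_atD chart_subset by blast
  assume "e \<in> interior (coord_cone C \<kappa> p)"
  then obtain T where T: "open T" "e \<in> T" "T \<subseteq> coord_cone C \<kappa> p" by (meson interiorE)
  define S where "S = tangent_space M p \<inter> (\<lambda>v. v \<kappa>) -` T"
  have "continuous_on UNIV (\<lambda>v::('a,'e) tangent. v \<kappa>)"
    by (rule continuous_on_product_coordinates)
  then have "openin (top_of_set (tangent_space M p)) S"
    unfolding S_def using T(1) by (intro openin_open_Int open_vimage)
  moreover have "S \<subseteq> C p"
  proof
    fix v assume v: "v \<in> S"
    then have "coord_vector M \<kappa> p (v \<kappa>) \<in> C p"
      using T(3) coord_cone_iff[OF assms] by (auto simp: S_def)
    moreover have "coord_vector M \<kappa> p (v \<kappa>) = v"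
      using v coord_vector_of_tangent[OF assms] by (simp add: S_def)
    ultimately show "v \<in> C p" by simp
  qed
  moreover have "coord_vector M \<kappa> p e \<in> S"
    unfolding S_def using T assms coord_vector_tangent by simp
  ultimately show "coord_vector M \<kappa> p e \<in> cone_interior M C p"
    unfolding cone_interior_def interior_of_def by blast
next
  assume "coord_vector M \<kappa> p e \<in> cone_interior M C p"
  then obtain S where S: "openin (top_of_set (tangent_space M p)) S" "coord_vector M \<kappa> p e \<in> S" "S \<subseteq> C p"
    unfolding cone_interior_def interior_of_def by blast
  then obtain T where T: "open T" "S = tangent_space M p \<inter> T" by (auto simp: openin_open)
  have "open (coord_vector M \<kappa> p -` T)"
    using open_vimage[OF T(1) continuous_coord_vector[OF assms]] .
  moreover have "coord_vector M \<kappa> p -` T \<subseteq> coord_cone C \<kappa> p"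
    using coord_cone_iff[OF assms] S T coord_vector_tangent[OF assms] by auto
  ultimately show "e \<in> interior (coord_cone C \<kappa> p)"
    using S T interior_maximal by (metis Int_iff subsetD vimageI)
qed

text \<open>A ball around \<open>0\<close> inside the cone would contain opposite vectors, contradicting pointedness.\<close>

lemma coord_cone_interior_nonzero:
  assumes "\<kappa> \<in> charts_at M p"
  shows "0 \<notin> interior (coord_cone C \<kappa> p)"
proof
  assume "0 \<in> interior (coord_cone C \<kappa> p)"
  then obtain r where r: "r > 0" "cball 0 r \<subseteq> coord_cone C \<kappa> p"
    by (auto simp: mem_interior_cball)
  obtain b :: 'e where b: "b \<in> Basis" by (metis all_not_in_conv nonempty_Basis)
  then have "r *\<^sub>R b \<in> cball 0 r" "- (r *\<^sub>R b) \<in> cball 0 r" using r by auto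
  then have "r *\<^sub>R b = 0" using r coord_cone_pointed[OF assms] by blast
  then show False using r b by (auto simp: nonzero_Basis)
qed

lemma coord_cone_interior_scale:
  assumes "\<kappa> \<in> charts_at M p" "v \<in> interior (coord_cone C \<kappa> p)" "c > 0"
  shows "c *\<^sub>R v \<in> interior (coord_cone C \<kappa> p)"
proof -
  have "(*\<^sub>R) c ` interior (coord_cone C \<kappa> p) \<subseteq> coord_cone C \<kappa> p"
    using assms coord_cone_scale interior_subset by fastforce
  moreover have "open ((*\<^sub>R) c ` interior (coord_cone C \<kappa> p))"
    using assms by (intro open_scaling) auto
  ultimately show ?thesis
    using assms(2) interior_maximal by blast
qed

end

section \<open>Differentials and partial derivatives in charts\<close>

context smooth_mfd
begin

text \<open>The definition of \<^const>\<open>differential\<close> fixes an arbitrary chart around \<open>p\<close>; by the chain rule any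
  chart gives the same coordinates.\<close>

lemma differential_coord:
  assumes \<kappa>: "\<kappa> \<in> charts_at M p" and \<kappa>': "\<kappa>' \<in> charts_at N (f p)" and v: "v \<in> tangent_space M p"
    and der: "((snd \<kappa>' \<circ> f \<circ> chart_inv \<kappa>) has_derivative f') (at (snd \<kappa> p))"
  shows "differential M N f p v \<kappa>' = f' (v \<kappa>)"
proof -
  define \<kappa>0 where "\<kappa>0 = (SOME \<kappa>. \<kappa> \<in> charts_at M p)"
  have \<kappa>0: "\<kappa>0 \<in> charts_at M p" unfolding \<kappa>0_def using \<kappa> by (rule someI)
  have p: "p \<in> fst \<kappa>" "p \<in> fst \<kappa>0" and at: "\<kappa> \<in> atlas M" "\<kappa>0 \<in> atlas M"
    using \<kappa> \<kappa>0 charts_atD by auto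
  have "((snd \<kappa>' \<circ> f \<circ> chart_inv \<kappa>) has_derivative f') (at ((snd \<kappa> \<circ> chart_inv \<kappa>0) (snd \<kappa>0 p)))"
    using der p at by simp
  from diff_chain_at[OF trans_deriv[OF \<kappa>0 \<kappa>] this]
  have 1: "((snd \<kappa>' \<circ> f \<circ> chart_inv \<kappa>) \<circ> (snd \<kappa> \<circ> chart_inv \<kappa>0) has_derivative
      f' \<circ> trans_deriv \<kappa>0 \<kappa> p) (at (snd \<kappa>0 p))" .
  have "eventually (\<lambda>u. u \<in> snd \<kappa>0 ` fst \<kappa>0 \<and> chart_inv \<kappa>0 u \<in> fst \<kappa>) (at (snd \<kappa>0 p))"
    using eventually_chart_nbhd[OF \<kappa>0] chart(1)[OF at(1)] p by blast
  then have ev: "eventually (\<lambda>u. ((snd \<kappa>' \<circ> f \<circ> chart_inv \<kappa>) \<circ> (snd \<kappa> \<circ> chart_inv \<kappa>0)) u =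
      (snd \<kappa>' \<circ> f \<circ> chart_inv \<kappa>0) u) (at (snd \<kappa>0 p))"
    by eventually_elim (use at in auto)
  have "((snd \<kappa>' \<circ> f \<circ> chart_inv \<kappa>0) has_derivative f' \<circ> trans_deriv \<kappa>0 \<kappa> p) (at (snd \<kappa>0 p))"
    by (rule has_derivative_transform_eventually[OF 1 ev]) (use p at in auto)
  then have "frechet_derivative (snd \<kappa>' \<circ> f \<circ> chart_inv \<kappa>0) (at (snd \<kappa>0 p)) =
      f' \<circ> trans_deriv \<kappa>0 \<kappa> p"
    using frechet_derivative_at by metis
  then show ?thesis
    using \<kappa>' tangent_space_trans[OF v \<kappa>0 \<kappa>]
    unfolding differential_def \<kappa>0_def[symmetric] Let_def by simp
qed

end

text \<open>The actions at hand, \<open>G \<times> M \<rightarrow> M\<close> and \<open>\<real> \<times> M \<rightarrow> M\<close>, are differentiable jointly. Restricting the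
  derivative to \<open>{0} \<times> E\<close> gives the derivatives of the individual maps \<open>f (a, -)\<close>, which thus depend
  continuously on \<open>a\<close> and on the point.\<close>

lemma partial_derivative_C1:
  fixes N :: "('a, 'd::euclidean_space) manifold" and M :: "('b, 'e::euclidean_space) manifold"
    and K :: "('c, 'f::euclidean_space) manifold"
  assumes N: "smooth_mfd N" and M: "smooth_mfd M" and f: "Ck_map 1 (prod_manifold N M) K f"
    and at: "\<kappa>N \<in> atlas N" "\<kappa> \<in> atlas M" "\<kappa>' \<in> atlas K"
  shows "\<exists>F'. (\<forall>a x. a \<in> fst \<kappa>N \<and> x \<in> fst \<kappa> \<and> f (a, x) \<in> fst \<kappa>' \<longrightarrow>
      ((snd \<kappa>' \<circ> (\<lambda>y. f (a, y)) \<circ> chart_inv \<kappa>) has_derivative F' (a, x)) (at (snd \<kappa> x))) \<and>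
    (\<forall>v. continuous_map (subtopology (prod_topology (mtop N) (mtop M))
        {z \<in> fst \<kappa>N \<times> fst \<kappa>. f z \<in> fst \<kappa>'}) euclidean (\<lambda>z. F' z v))"
proof -
  interpret N: smooth_mfd N by fact
  interpret M: smooth_mfd M by fact
  define \<kappa>P where "\<kappa>P = (fst \<kappa>N \<times> fst \<kappa>, \<lambda>(x, y). (snd \<kappa>N x, snd \<kappa> y))"
  define D where "D = {z \<in> fst \<kappa>N \<times> fst \<kappa>. f z \<in> fst \<kappa>'}"
  have "\<kappa>P \<in> atlas (prod_manifold N M)"
    using at(1,2) unfolding \<kappa>P_def prod_manifold_def by (simp del: split_paired_Ex) blast
  then have "Ck_on (Suc 0) (snd \<kappa>' \<circ> f \<circ> chart_inv \<kappa>P) (snd \<kappa>P ` {z \<in> fst \<kappa>P. f z \<in> fst \<kappa>'})"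
    using f at(3) unfolding Ck_map_def One_nat_def by blast
  then have "Ck_on (Suc 0) (snd \<kappa>' \<circ> f \<circ> chart_inv \<kappa>P) (snd \<kappa>P ` D)"
    by (simp add: D_def \<kappa>P_def)
  then obtain g' where
    g': "\<And>u. u \<in> snd \<kappa>P ` D \<Longrightarrow> ((snd \<kappa>' \<circ> f \<circ> chart_inv \<kappa>P) has_derivative g' u) (at u)"
    and cont: "\<And>v. continuous_on (snd \<kappa>P ` D) (\<lambda>u. g' u v)"
    unfolding Ck_on.simps by blast
  have "inj_on (snd \<kappa>P) (fst \<kappa>P)"
    using N.chart_inj[OF at(1)] M.chart_inj[OF at(2)] by (auto simp: \<kappa>P_def inj_on_def)
  then have inv: "chart_inv \<kappa>P (snd \<kappa>N a, snd \<kappa> x) = (a, x)" if "a \<in> fst \<kappa>N" "x \<in> fst \<kappa>" for a x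
    using inv_into_f_f[of "snd \<kappa>P" "fst \<kappa>P" "(a, x)"] that by (simp add: chart_inv_def \<kappa>P_def)
  define F' where "F' z v = g' (snd \<kappa>P z) (0, v)" for z v
  show ?thesis
  proof (intro exI[of _ F'] conjI allI impI; (elim conjE)?)
    fix a x assume ax: "a \<in> fst \<kappa>N" "x \<in> fst \<kappa>" "f (a, x) \<in> fst \<kappa>'"
    then have "snd \<kappa>P (a, x) \<in> snd \<kappa>P ` D" by (intro imageI) (simp add: D_def)
    from g'[OF this]
    have g: "((snd \<kappa>' \<circ> f \<circ> chart_inv \<kappa>P) has_derivative g' (snd \<kappa>N a, snd \<kappa> x)) (at (snd \<kappa>N a, snd \<kappa> x))"
      by (simp add: \<kappa>P_def)
    have "((\<lambda>u. (snd \<kappa>N a, u)) has_derivative (\<lambda>v. (0, v))) (at (snd \<kappa> x))"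
      by (intro derivative_eq_intros) auto
    from diff_chain_at[OF this g]
    have 1: "((snd \<kappa>' \<circ> f \<circ> chart_inv \<kappa>P) \<circ> (\<lambda>u. (snd \<kappa>N a, u)) has_derivative F' (a, x)) (at (snd \<kappa> x))"
      by (simp add: F'_def[abs_def] \<kappa>P_def o_def)
    have "\<kappa> \<in> charts_at M x" using ax at by (simp add: charts_at_def)
    from M.eventually_in_chart[OF this]
    have ev: "eventually (\<lambda>u. ((snd \<kappa>' \<circ> f \<circ> chart_inv \<kappa>P) \<circ> (\<lambda>u. (snd \<kappa>N a, u))) u =
       (snd \<kappa>' \<circ> (\<lambda>y. f (a, y)) \<circ> chart_inv \<kappa>) u) (at (snd \<kappa> x))"
      by eventually_elim (use ax at inv in auto)
    show "((snd \<kappa>' \<circ> (\<lambda>y. f (a, y)) \<circ> chart_inv \<kappa>) has_derivative F' (a, x)) (at (snd \<kappa> x))"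
      by (rule has_derivative_transform_eventually[OF 1 ev]) (use ax at inv in auto)
  next
    fix v
    let ?X = "subtopology (prod_topology (mtop N) (mtop M)) D"
    have "continuous_map ?X (subtopology (mtop N) (fst \<kappa>N)) fst"
      by (auto simp: continuous_map_in_subtopology D_def intro: continuous_map_from_subtopology continuous_map_fst)
    from continuous_map_compose[OF this N.continuous_map_chart[OF at(1)]]
    have 1: "continuous_map ?X euclidean (snd \<kappa>N \<circ> fst)" .
    have "continuous_map ?X (subtopology (mtop M) (fst \<kappa>)) snd"
      by (auto simp: continuous_map_in_subtopology D_def intro: continuous_map_from_subtopology continuous_map_snd)
    from continuous_map_compose[OF this M.continuous_map_chart[OF at(2)]]
    have 2: "continuous_map ?X euclidean (snd \<kappa> \<circ> snd)" .
    have "continuous_map ?X (prod_topology euclidean euclidean) (\<lambda>z. ((snd \<kappa>N \<circ> fst) z, (snd \<kappa> \<circ> snd) z))"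
      using 1 2 continuous_map_pairedI by blast
    moreover have "(\<lambda>z. ((snd \<kappa>N \<circ> fst) z, (snd \<kappa> \<circ> snd) z)) = snd \<kappa>P"
      by (auto simp: \<kappa>P_def)
    ultimately have "continuous_map ?X (top_of_set (snd \<kappa>P ` D)) (snd \<kappa>P)"
      by (auto simp: euclidean_product_topology continuous_map_in_subtopology)
    moreover have "continuous_map (top_of_set (snd \<kappa>P ` D)) euclidean (\<lambda>u. g' u (0, v))"
      using cont by auto
    ultimately have "continuous_map ?X euclidean ((\<lambda>u. g' u (0, v)) \<circ> snd \<kappa>P)"
      using continuous_map_compose by blast
    then show "continuous_map (subtopology (prod_topology (mtop N) (mtop M))
        {z \<in> fst \<kappa>N \<times> fst \<kappa>. f z \<in> fst \<kappa>'}) euclidean (\<lambda>z. F' z v)"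
      unfolding D_def[symmetric] F'_def[abs_def] o_def .
  qed
qed

lemma norm_linear_diff_le:
  fixes A B :: "'e::euclidean_space \<Rightarrow> 'f::real_normed_vector"
  assumes "linear A" "linear B" "\<And>b. b \<in> Basis \<Longrightarrow> norm (A b - B b) \<le> \<epsilon> / DIM('e)"
  shows "norm (A v - B v) \<le> \<epsilon> * norm v"
proof -
  have lin: "linear (\<lambda>v. A v - B v)" using assms linear_compose_sub by blast
  have "A v - B v = (\<Sum>b\<in>Basis. (v \<bullet> b) *\<^sub>R (A b - B b))"
    using linear_sum[OF lin, of "\<lambda>b. (v \<bullet> b) *\<^sub>R b" Basis] linear_scale[OF lin]
    by (simp add: euclidean_representation)
  also have "norm \<dots> \<le> (\<Sum>b\<in>(Basis::'e set). norm v * (\<epsilon> / DIM('e)))"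
  proof (rule sum_norm_le)
    fix b :: 'e assume b: "b \<in> Basis"
    show "norm ((v \<bullet> b) *\<^sub>R (A b - B b)) \<le> norm v * (\<epsilon> / DIM('e))"
      unfolding norm_scaleR by (rule mult_mono[OF Basis_le_norm[OF b] assms(3)[OF b]]) auto
  qed
  also have "\<dots> = \<epsilon> * norm v" by simp
  finally show ?thesis .
qed

text \<open>In finite dimension, pointwise continuity of a family of linear maps is continuity in the
  operator norm, since closeness need only be tested on the basis.\<close>

lemma linear_family_near:
  fixes D :: "'a \<Rightarrow> 'e::euclidean_space \<Rightarrow> 'f::real_normed_vector"
  assumes W0: "openin X W0" "x0 \<in> W0" and lin: "\<And>z. z \<in> W0 \<Longrightarrow> linear (D z)"
    and cont: "\<And>v. continuous_map (subtopology X W0) euclidean (\<lambda>z. D z v)" and \<epsilon>: "\<epsilon> > 0"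
  obtains W where "openin X W" "x0 \<in> W" "W \<subseteq> W0"
    "\<And>z v. z \<in> W \<Longrightarrow> norm (D z v - D x0 v) \<le> \<epsilon> * norm v"
proof
  let ?W = "W0 \<inter> (\<Inter>b\<in>Basis. {z \<in> W0. D z b \<in> ball (D x0 b) (\<epsilon> / DIM('e))})"
  have "openin X {z \<in> W0. D z b \<in> ball (D x0 b) (\<epsilon> / DIM('e))}" for b
    by (rule openin_preimage_on_open[OF W0(1) cont]) simp
  then show "openin X ?W" using W0(1) by (intro openin_Int openin_INT2) auto
  show "x0 \<in> ?W" using W0(2) \<epsilon> by auto
  show "?W \<subseteq> W0" by auto
  fix z v assume z: "z \<in> ?W"
  show "norm (D z v - D x0 v) \<le> \<epsilon> * norm v"
  proof (rule norm_linear_diff_le)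
    fix b :: 'e assume "b \<in> Basis"
    then have "dist (D x0 b) (D z b) < \<epsilon> / DIM('e)" using z by auto
    then show "norm (D z b - D x0 b) \<le> \<epsilon> / DIM('e)" by (simp add: dist_norm norm_minus_commute)
  qed (use z W0(2) lin in auto)
qed

section \<open>Continuity of a homogeneous cone field\<close>

locale homogeneous_cone_mfd =
  fixes G :: "('g, 'b) monoid_scheme" and L :: "('g, 'e::euclidean_space) manifold"
    and H :: "'g set" and M :: "('g set, 'n::euclidean_space) manifold" and C :: "('g set, 'n) cone_field"
  assumes homogeneous: "homogeneous_space G L H M"
    and cones: "is_cone_field M C"
    and homogeneous_cones: "homogeneous_cone_field G M C"

sublocale homogeneous_cone_mfd \<subseteq> cone_mfd M C
  using homogeneous cones by unfold_locales (auto simp: homogeneous_space_def)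

context homogeneous_cone_mfd
begin

lemma group: "group G" and subgroup: "subgroup H G" and carrier: "topspace (mtop L) = carrier G"
  and lie: "smooth_mfd L"
  using homogeneous by (auto simp: homogeneous_space_def lie_group_def smooth_mfd_def)

text \<open>For \<open>p = aH\<close> the preimage of \<open>W \<cdot> p\<close> under the projection \<open>G \<rightarrow> G/H\<close> is \<open>W a H\<close>, a union of right
  translates of \<open>W\<close>. Hence every point near \<open>p\<close> is reached from \<open>p\<close> by a group element near the unit.\<close>

lemma openin_orbit:
  assumes p: "p \<in> topspace (mtop M)" and W: "openin (mtop L) W"
  shows "openin (mtop M) ((\<lambda>g. g <#\<^bsub>G\<^esub> p) ` W)"
proof -
  interpret group G by (rule group)
  have H: "H \<subseteq> carrier G" using subgroup subgroup.subset by blast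
  obtain a where a: "a \<in> carrier G" "p = a <#\<^bsub>G\<^esub> H"
    using p homogeneous by (auto simp: homogeneous_space_def LCOSETS_def)
  have Wc: "W \<subseteq> carrier G" using W openin_subset carrier by metis
  have right: "openin (mtop L) {b \<in> carrier G. b \<otimes>\<^bsub>G\<^esub> c \<in> W}" if "c \<in> carrier G" for c
  proof -
    have "continuous_map (prod_topology (mtop L) (mtop L)) (mtop L) (\<lambda>(a, b). a \<otimes>\<^bsub>G\<^esub> b)"
      using homogeneous by (auto simp: homogeneous_space_def lie_group_def smooth_map_def Ck_map_def prod_manifold_def)
    moreover have "continuous_map (mtop L) (prod_topology (mtop L) (mtop L)) (\<lambda>b. (b, c))"
      using that carrier by (intro continuous_map_pairedI) auto
    ultimately have "continuous_map (mtop L) (mtop L) ((\<lambda>(a, b). a \<otimes>\<^bsub>G\<^esub> b) \<circ> (\<lambda>b. (b, c)))"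
      using continuous_map_compose by blast
    from openin_continuous_map_preimage[OF this W] show ?thesis by (simp add: carrier)
  qed
  let ?U = "(\<lambda>g. g <#\<^bsub>G\<^esub> p) ` W"
  have mem: "g <#\<^bsub>G\<^esub> p = (g \<otimes>\<^bsub>G\<^esub> a) <#\<^bsub>G\<^esub> H" if "g \<in> carrier G" for g
    using that a H lcos_m_assoc by metis
  have "{b \<in> carrier G. b <#\<^bsub>G\<^esub> H \<in> ?U} = (\<Union>h\<in>H. {b \<in> carrier G. b \<otimes>\<^bsub>G\<^esub> inv\<^bsub>G\<^esub> (a \<otimes>\<^bsub>G\<^esub> h) \<in> W})" (is "?l = ?r")
  proof (intro equalityI subsetI)
    fix b assume "b \<in> ?l"
    then obtain g where b: "b \<in> carrier G" and g: "g \<in> W" "b <#\<^bsub>G\<^esub> H = g <#\<^bsub>G\<^esub> p" by auto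
    have gc: "g \<in> carrier G" using g Wc by auto
    have "b \<in> (g \<otimes>\<^bsub>G\<^esub> a) <#\<^bsub>G\<^esub> H" using lcos_self[OF b subgroup] g mem[OF gc] by simp
    then obtain h where h: "h \<in> H" "b = g \<otimes>\<^bsub>G\<^esub> a \<otimes>\<^bsub>G\<^esub> h" by (auto simp: l_coset_def)
    then have "b \<otimes>\<^bsub>G\<^esub> inv\<^bsub>G\<^esub> (a \<otimes>\<^bsub>G\<^esub> h) = g"
      using gc a H by (metis b inv_solve_right m_assoc m_closed subsetD)
    then have "b \<otimes>\<^bsub>G\<^esub> inv\<^bsub>G\<^esub> (a \<otimes>\<^bsub>G\<^esub> h) \<in> W" using g by simp
    then show "b \<in> ?r" using h(1) b by blast
  next
    fix b assume "b \<in> ?r"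
    then obtain h where h: "h \<in> H" "b \<in> carrier G" "b \<otimes>\<^bsub>G\<^esub> inv\<^bsub>G\<^esub> (a \<otimes>\<^bsub>G\<^esub> h) \<in> W" by auto
    let ?g = "b \<otimes>\<^bsub>G\<^esub> inv\<^bsub>G\<^esub> (a \<otimes>\<^bsub>G\<^esub> h)"
    have hc: "h \<in> carrier G" using h H by auto
    have gc: "?g \<in> carrier G" using h Wc by auto
    have "b = (?g \<otimes>\<^bsub>G\<^esub> a) \<otimes>\<^bsub>G\<^esub> h"
      using h hc a gc by (simp add: m_assoc)
    then have "b \<in> (?g \<otimes>\<^bsub>G\<^esub> a) <#\<^bsub>G\<^esub> H" using h unfolding l_coset_def by blast
    then have "b <#\<^bsub>G\<^esub> H = ?g <#\<^bsub>G\<^esub> p"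
      using l_repr_independence[of b "?g \<otimes>\<^bsub>G\<^esub> a" H] gc a subgroup mem[OF gc] by simp
    then show "b \<in> ?l" using h by auto
  qed
  moreover have "openin (mtop L) ?r"
    using right a H by (intro openin_Union) auto
  ultimately have pre: "openin (mtop L) {b \<in> topspace (mtop L). b <#\<^bsub>G\<^esub> H \<in> ?U}"
    by (simp add: carrier)
  have "?U \<subseteq> topspace (mtop M)"
  proof
    fix q assume "q \<in> ?U"
    then obtain g where "g \<in> carrier G" "q = (g \<otimes>\<^bsub>G\<^esub> a) <#\<^bsub>G\<^esub> H" using mem Wc by auto
    then show "q \<in> topspace (mtop M)"
      using a homogeneous by (auto simp: homogeneous_space_def LCOSETS_def)
  qed
  moreover have "quotient_map (mtop L) (mtop M) (\<lambda>a. a <#\<^bsub>G\<^esub> H)"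
    using homogeneous by (auto simp: homogeneous_space_def)
  ultimately show ?thesis
    using pre unfolding quotient_map_def by blast
qed

text \<open>Near \<open>p\<close> every point is \<open>g \<cdot> p\<close> with \<open>g\<close> close to the unit. The differential of \<open>\<lambda>\<^sub>g\<close> at \<open>p\<close> carries the
  cone at \<open>p\<close> onto the cone at \<open>g \<cdot> p\<close> and is close to the differential of \<open>\<lambda>\<^sub>e\<close>, the identity.\<close>

lemma coord_cone_transport:
  assumes \<kappa>: "\<kappa> \<in> charts_at M p" and \<epsilon>: "\<epsilon> > 0"
  obtains U where "openin (mtop M) U" "p \<in> U" "U \<subseteq> fst \<kappa>"
    "\<And>q. q \<in> U \<Longrightarrow> \<exists>A. linear A \<and> A ` coord_cone C \<kappa> p = coord_cone C \<kappa> q \<and>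
       (\<forall>v. norm (A v - v) \<le> \<epsilon> * norm v)"
proof -
  interpret group G by (rule group)
  interpret L: smooth_mfd L by (rule lie)
  have at: "\<kappa> \<in> atlas M" and pk: "p \<in> fst \<kappa>" using \<kappa> charts_atD by auto
  then have p: "p \<in> topspace (mtop M)" using chart_subset by blast
  let ?e = "\<one>\<^bsub>G\<^esub>"
  let ?f = "\<lambda>(g, x). g <#\<^bsub>G\<^esub> x"
  have "?e \<in> topspace (mtop L)" using carrier by simp
  then obtain \<kappa>e where \<kappa>e: "\<kappa>e \<in> atlas L" "?e \<in> fst \<kappa>e"
    using L.ex_chart L.charts_atD by blast
  have ep: "?e <#\<^bsub>G\<^esub> p = p"
    using p homogeneous subgroup.lcosets_carrier[OF subgroup group] lcos_mult_one
    by (auto simp: homogeneous_space_def)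
  have smooth_f: "smooth_map (prod_manifold L M) M ?f"
    using homogeneous by (auto simp: homogeneous_space_def)
  then have C1_f: "Ck_map 1 (prod_manifold L M) M ?f" by (simp add: smooth_map_def)
  obtain F' where
    F0: "\<forall>a x. a \<in> fst \<kappa>e \<and> x \<in> fst \<kappa> \<and> ?f (a, x) \<in> fst \<kappa> \<longrightarrow>
      ((snd \<kappa> \<circ> (\<lambda>y. ?f (a, y)) \<circ> chart_inv \<kappa>) has_derivative F' (a, x)) (at (snd \<kappa> x))"
    and cont0: "\<forall>v. continuous_map (subtopology (prod_topology (mtop L) (mtop M))
        {z \<in> fst \<kappa>e \<times> fst \<kappa>. ?f z \<in> fst \<kappa>}) euclidean (\<lambda>z. F' z v)"
    using partial_derivative_C1[OF lie smooth_mfd_axioms C1_f \<kappa>e(1) at at] by (elim exE conjE) (rule that)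
  have F': "((snd \<kappa> \<circ> (\<lambda>y. a <#\<^bsub>G\<^esub> y) \<circ> chart_inv \<kappa>) has_derivative F' (a, x)) (at (snd \<kappa> x))"
    if "a \<in> fst \<kappa>e" "x \<in> fst \<kappa>" "a <#\<^bsub>G\<^esub> x \<in> fst \<kappa>" for a x
    using F0[rule_format, of a x] that by simp
  note cont = cont0[rule_format]
  have cont_f: "continuous_map (prod_topology (mtop L) (mtop M)) (mtop M) ?f"
    using smooth_f by (auto simp: smooth_map_def Ck_map_def prod_manifold_def)
  have cont_p: "continuous_map (mtop L) (prod_topology (mtop L) (mtop M)) (\<lambda>g. (g, p))"
    using p by (intro continuous_map_pairedI) auto
  define D where "D = {g \<in> fst \<kappa>e. g <#\<^bsub>G\<^esub> p \<in> fst \<kappa>}"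
  have "openin (mtop L) {g \<in> topspace (mtop L). (?f \<circ> (\<lambda>g. (g, p))) g \<in> fst \<kappa>}"
    using openin_continuous_map_preimage[OF continuous_map_compose[OF cont_p cont_f] chart(1)[OF at]] .
  then have "openin (mtop L) (fst \<kappa>e \<inter> {g \<in> topspace (mtop L). (?f \<circ> (\<lambda>g. (g, p))) g \<in> fst \<kappa>})"
    using L.chart(1)[OF \<kappa>e(1)] by blast
  moreover have "fst \<kappa>e \<inter> {g \<in> topspace (mtop L). (?f \<circ> (\<lambda>g. (g, p))) g \<in> fst \<kappa>} = D"
    using L.chart_subset[OF \<kappa>e(1)] by (auto simp: D_def)
  ultimately have openD: "openin (mtop L) D" by simp
  have contD: "continuous_map (subtopology (mtop L) D) euclidean (\<lambda>g. F' (g, p) v)" for v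
  proof -
    have "continuous_map (subtopology (mtop L) D) (subtopology (prod_topology (mtop L) (mtop M))
        {z \<in> fst \<kappa>e \<times> fst \<kappa>. ?f z \<in> fst \<kappa>}) (\<lambda>g. (g, p))"
      using continuous_map_from_subtopology[OF cont_p] pk
      by (auto simp: continuous_map_in_subtopology D_def)
    from continuous_map_compose[OF this cont] show ?thesis by (simp add: o_def)
  qed
  have eD: "?e \<in> D" using \<kappa>e pk ep by (simp add: D_def)
  have lin: "linear (F' (g, p))" if "g \<in> D" for g
    using F'[of g p] that pk has_derivative_linear by (auto simp: D_def)
  have id: "F' (?e, p) v = v" for v
  proof -
    have d: "((snd \<kappa> \<circ> (\<lambda>y. ?e <#\<^bsub>G\<^esub> y) \<circ> chart_inv \<kappa>) has_derivative F' (?e, p)) (at (snd \<kappa> p))"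
      using F'[of ?e p] \<kappa>e pk ep by simp
    have one: "?e <#\<^bsub>G\<^esub> y = y" if "y \<in> fst \<kappa>" for y
      using that chart_subset[OF at] homogeneous subgroup.lcosets_carrier[OF subgroup group] lcos_mult_one
      by (auto simp: homogeneous_space_def)
    have ev: "eventually (\<lambda>u. (snd \<kappa> \<circ> (\<lambda>y. ?e <#\<^bsub>G\<^esub> y) \<circ> chart_inv \<kappa>) u = u) (at (snd \<kappa> p))"
      using eventually_in_chart[OF \<kappa>] by eventually_elim (use one in auto)
    have "((\<lambda>u. u) has_derivative F' (?e, p)) (at (snd \<kappa> p))"
      by (rule has_derivative_transform_eventually[OF d ev]) (use one pk at in auto)
    from has_derivative_unique[OF this has_derivative_ident] show ?thesis by metis
  qed
  obtain W where openW: "openin (mtop L) W" and eW: "?e \<in> W" and WD: "W \<subseteq> D"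
    and near: "\<And>g v. g \<in> W \<Longrightarrow> norm (F' (g, p) v - F' (?e, p) v) \<le> \<epsilon> * norm v"
    using linear_family_near[OF openD eD lin contD \<epsilon>] by metis
  show thesis
  proof
    show "openin (mtop M) ((\<lambda>g. g <#\<^bsub>G\<^esub> p) ` W)" using openin_orbit[OF p openW] .
    show "p \<in> (\<lambda>g. g <#\<^bsub>G\<^esub> p) ` W" using eW ep by force
    show "(\<lambda>g. g <#\<^bsub>G\<^esub> p) ` W \<subseteq> fst \<kappa>" using WD by (auto simp: D_def)
  next
    fix q assume "q \<in> (\<lambda>g. g <#\<^bsub>G\<^esub> p) ` W"
    then obtain g where g: "g \<in> W" "q = g <#\<^bsub>G\<^esub> p" by auto
    then have gD: "g \<in> D" using WD by blast
    have gc: "g \<in> carrier G" using g(1) openin_subset[OF openW] carrier by auto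
    have der: "((snd \<kappa> \<circ> (\<lambda>y. g <#\<^bsub>G\<^esub> y) \<circ> chart_inv \<kappa>) has_derivative F' (g, p)) (at (snd \<kappa> p))"
      using F'[of g p] gD pk by (auto simp: D_def)
    have \<kappa>q: "\<kappa> \<in> charts_at M (g <#\<^bsub>G\<^esub> p)" using gD at by (simp add: D_def charts_at_def)
    have "C q = differential M M (\<lambda>y. g <#\<^bsub>G\<^esub> y) p ` C p"
      using homogeneous_cones gc p g by (simp add: homogeneous_cone_field_def)
    then have "coord_cone C \<kappa> q = (\<lambda>v. differential M M (\<lambda>y. g <#\<^bsub>G\<^esub> y) p v \<kappa>) ` C p"
      by (simp add: coord_cone_def image_image)
    also have "\<dots> = (\<lambda>v. F' (g, p) (v \<kappa>)) ` C p"
      using differential_coord[OF \<kappa> \<kappa>q _ der] cone_subset[OF p] by (intro image_cong) auto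
    finally have "F' (g, p) ` coord_cone C \<kappa> p = coord_cone C \<kappa> q"
      by (simp add: coord_cone_def image_image)
    moreover have "norm (F' (g, p) v - v) \<le> \<epsilon> * norm v" for v
      using near[OF g(1), of v] by (simp only: id)
    ultimately show "\<exists>A. linear A \<and> A ` coord_cone C \<kappa> p = coord_cone C \<kappa> q \<and>
       (\<forall>v. norm (A v - v) \<le> \<epsilon> * norm v)"
      using lin[OF gD] by blast
  qed
qed

text \<open>Membership in a nearby cone is decided by a slightly moved vector in the cone at \<open>p\<close>, namely the
  preimage under the transport map. Both the openness of the interiors and the closedness of the
  cones as subsets of the tangent bundle follow from this.\<close>

lemma coord_cone_continuity:
  assumes \<kappa>: "\<kappa> \<in> charts_at M p" and \<eta>: "\<eta> > 0"
  obtains U \<delta> where "openin (mtop M) U" "p \<in> U" "U \<subseteq> fst \<kappa>" "\<delta> > 0"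
    "\<And>q v. \<lbrakk>q \<in> U; v \<in> ball w \<delta>\<rbrakk> \<Longrightarrow> \<exists>v'\<in>ball w \<eta>. v \<in> coord_cone C \<kappa> q \<longleftrightarrow> v' \<in> coord_cone C \<kappa> p"
proof -
  define \<delta> where "\<delta> = \<eta> / 2"
  \<comment> \<open>The bound \<open>1/2\<close> makes the transport map \<open>A\<close> invertible with \<open>norm (A\<^sup>-\<^sup>1 v) \<le> 2 * norm v\<close>; the other one
    then bounds \<open>norm (v - A\<^sup>-\<^sup>1 v)\<close> by \<open>\<eta> / 2\<close> for \<open>v\<close> within \<open>\<eta>\<close> of \<open>w\<close>.\<close>
  define \<epsilon> where "\<epsilon> = min (1/2) (\<eta> / (4 * (norm w + \<eta>)))"
  have wp: "norm w + \<eta> > 0" using \<eta> by (simp add: add_nonneg_pos)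
  have \<epsilon>: "\<epsilon> > 0" using \<eta> wp by (simp add: \<epsilon>_def)
  obtain U where U: "openin (mtop M) U" "p \<in> U" "U \<subseteq> fst \<kappa>"
    and tr: "\<And>q. q \<in> U \<Longrightarrow> \<exists>A. linear A \<and> A ` coord_cone C \<kappa> p = coord_cone C \<kappa> q \<and>
       (\<forall>v. norm (A v - v) \<le> \<epsilon> * norm v)"
    using coord_cone_transport[OF \<kappa> \<epsilon>] by metis
  show thesis
  proof
    show "openin (mtop M) U" "p \<in> U" "U \<subseteq> fst \<kappa>" "\<delta> > 0" using U \<eta> by (auto simp: \<delta>_def)
    fix q v assume q: "q \<in> U" and v: "v \<in> ball w \<delta>"
    obtain A where A: "linear A" "A ` coord_cone C \<kappa> p = coord_cone C \<kappa> q"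
      and near: "\<And>v. norm (A v - v) \<le> \<epsilon> * norm v"
      using tr[OF q] by metis
    have half: "norm (A v - v) \<le> norm v / 2" for v
    proof -
      have "\<epsilon> \<le> 1/2" unfolding \<epsilon>_def by (rule min.cobounded1)
      then have "\<epsilon> * norm v \<le> 1/2 * norm v" by (rule mult_right_mono) simp
      then show ?thesis using near[of v] by simp
    qed
    have "v = 0" if "A v = 0" for v
      using half[of v] that by simp
    then have inj: "inj A" using A(1) linear_injective_0 by blast
    then have "surj A" using A(1) linear_injective_imp_surjective by blast
    then obtain v' where v': "v = A v'" by (metis surjD)
    have "norm v' \<le> norm v + norm (A v' - v')" 
      using norm_triangle_ineq4[of "A v'" "A v' - v'"] v' by simp
    then have "norm v' \<le> 2 * norm v" using half[of v'] by simp
    moreover have "norm v < norm w + \<eta>"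
      using v norm_triangle_ineq2[of v w] \<eta> by (simp add: \<delta>_def dist_norm norm_minus_commute)
    ultimately have "norm v' < 2 * (norm w + \<eta>)" by simp
    then have "\<epsilon> * norm v' < \<epsilon> * (2 * (norm w + \<eta>))" using \<epsilon> by (rule mult_strict_left_mono)
    also have "\<dots> \<le> \<eta> / (4 * (norm w + \<eta>)) * (2 * (norm w + \<eta>))"
      using wp by (intro mult_right_mono) (auto simp: \<epsilon>_def)
    also have "\<dots> = \<eta> / 2" using wp by (simp add: field_simps)
    finally have "norm (v - v') < \<eta> / 2" using near[of v'] v' by simp
    then have "dist w v' < \<eta>"
      using v dist_triangle[of w v' v] by (simp add: \<delta>_def dist_norm)
    moreover have "v \<in> coord_cone C \<kappa> q \<longleftrightarrow> v' \<in> coord_cone C \<kappa> p"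
      using A(2) inj v' by (metis inj_image_mem_iff)
    ultimately show "\<exists>v'\<in>ball w \<eta>. v \<in> coord_cone C \<kappa> q \<longleftrightarrow> v' \<in> coord_cone C \<kappa> p"
      by auto
  qed
qed

lemma interior_coord_cone_nbhd:
  assumes \<kappa>: "\<kappa> \<in> charts_at M p" and w: "w \<in> interior (coord_cone C \<kappa> p)"
  obtains U \<delta> where "openin (mtop M) U" "p \<in> U" "U \<subseteq> fst \<kappa>" "\<delta> > 0"
    "\<And>q v. \<lbrakk>q \<in> U; v \<in> ball w \<delta>\<rbrakk> \<Longrightarrow> v \<in> interior (coord_cone C \<kappa> q)"
proof -
  obtain \<eta> where \<eta>: "\<eta> > 0" "ball w \<eta> \<subseteq> coord_cone C \<kappa> p" using w mem_interior by blast
  obtain U \<delta> where U: "openin (mtop M) U" "p \<in> U" "U \<subseteq> fst \<kappa>" "\<delta> > 0"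
    and *: "\<And>q v. \<lbrakk>q \<in> U; v \<in> ball w \<delta>\<rbrakk> \<Longrightarrow> \<exists>v'\<in>ball w \<eta>. v \<in> coord_cone C \<kappa> q \<longleftrightarrow> v' \<in> coord_cone C \<kappa> p"
    using coord_cone_continuity[OF \<kappa> \<eta>(1)] by metis
  have "ball w \<delta> \<subseteq> interior (coord_cone C \<kappa> q)" if "q \<in> U" for q
    using * that \<eta> by (intro interior_maximal) blast+
  then show thesis using U that by blast
qed

lemma not_in_coord_cone_nbhd:
  assumes \<kappa>: "\<kappa> \<in> charts_at M p" and w: "w \<notin> coord_cone C \<kappa> p"
  obtains U \<delta> where "openin (mtop M) U" "p \<in> U" "U \<subseteq> fst \<kappa>" "\<delta> > 0"
    "\<And>q v. \<lbrakk>q \<in> U; v \<in> ball w \<delta>\<rbrakk> \<Longrightarrow> v \<notin> coord_cone C \<kappa> q"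
proof -
  have "open (- coord_cone C \<kappa> p)" using coord_cone_closed[OF \<kappa>] by blast
  then obtain \<eta> where \<eta>: "\<eta> > 0" "ball w \<eta> \<subseteq> - coord_cone C \<kappa> p"
    using w open_contains_ball by (metis ComplI)
  obtain U \<delta> where U: "openin (mtop M) U" "p \<in> U" "U \<subseteq> fst \<kappa>" "\<delta> > 0"
    and *: "\<And>q v. \<lbrakk>q \<in> U; v \<in> ball w \<delta>\<rbrakk> \<Longrightarrow> \<exists>v'\<in>ball w \<eta>. v \<in> coord_cone C \<kappa> q \<longleftrightarrow> v' \<in> coord_cone C \<kappa> p"
    using coord_cone_continuity[OF \<kappa> \<eta>(1)] by metis
  have "v \<notin> coord_cone C \<kappa> q" if "q \<in> U" "v \<in> ball w \<delta>" for q v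
    using *[OF that] \<eta>(2) by blast
  then show thesis using that[OF U] by blast
qed

end

section \<open>Curves with derivative in an open convex cone\<close>

text \<open>If the increment were outside \<open>K\<close>, a hyperplane would separate it from \<open>K\<close>: a linear functional \<open>n\<close>
  positive on \<open>K\<close> with \<open>n \<bullet> (\<sigma> b - \<sigma> a) \<le> 0\<close>. But \<open>n \<bullet> \<sigma>\<close> is nondecreasing, hence constant, so the
  derivative of \<open>\<sigma>\<close> is annihilated by \<open>n\<close> and must vanish. The derivative may be zero on an arbitrary
  set, which is the situation for the image of a conal curve.\<close>

lemma increment_in_convex_cone:
  fixes \<sigma> :: "real \<Rightarrow> 'e::euclidean_space"
  assumes K: "open K" "convex K" and cone: "\<And>v c. v \<in> K \<Longrightarrow> c > 0 \<Longrightarrow> c *\<^sub>R v \<in> K"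
    and ab: "a \<le> b" and cont: "continuous_on {a..b} \<sigma>" and S: "finite S"
    and der: "\<And>t. t \<in> {a<..<b} - S \<Longrightarrow> \<exists>d. (\<sigma> has_vector_derivative d) (at t) \<and> (d = 0 \<or> d \<in> K)"
  shows "(\<forall>t\<in>{a..b}. \<sigma> t = \<sigma> a) \<or> \<sigma> b - \<sigma> a \<in> K"
proof (cases "\<sigma> b - \<sigma> a \<in> K")
  case False
  obtain d0 where d0: "\<And>t. t \<in> {a<..<b} - S \<Longrightarrow> (\<sigma> has_vector_derivative d0 t) (at t) \<and> (d0 t = 0 \<or> d0 t \<in> K)"
    using der by metis
  define d where "d t = (if t \<in> {a<..<b} - S then d0 t else 0)" for t
  have int: "(d has_integral (\<sigma> t - \<sigma> s)) {s..t}" if "a \<le> s" "s \<le> t" "t \<le> b" for s t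
  proof (rule fundamental_theorem_of_calculus_interior_strong[OF S])
    show "continuous_on {s..t} \<sigma>" using cont that by (auto intro: continuous_on_subset)
  qed (use d0 that in \<open>auto simp: d_def\<close>)
  have d_zero: "d t = 0" for t
  proof (cases "K = {}")
    case True
    then show ?thesis using d0 by (auto simp: d_def)
  next
    case False
    then obtain n c where n: "n \<noteq> 0" "n \<bullet> (\<sigma> b - \<sigma> a) \<le> c" "\<And>k. k \<in> K \<Longrightarrow> c \<le> n \<bullet> k"
      using separating_hyperplane_sets[of "{\<sigma> b - \<sigma> a}" K] K(2) \<open>\<sigma> b - \<sigma> a \<notin> K\<close> by auto
    have scaled: "c \<le> l * (n \<bullet> k)" if "k \<in> K" "l > 0" for k l
      using n(3)[OF cone[OF that]] by simp
    \<comment> \<open>\<open>n\<close> is bounded below on the cone, so scaling up excludes negative values.\<close>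
    have nonneg: "n \<bullet> k \<ge> 0" if k: "k \<in> K" for k
    proof (rule ccontr)
      assume neg: "\<not> n \<bullet> k \<ge> 0"
      define l where "l = (\<bar>c\<bar> + 1) / - (n \<bullet> k)"
      have "l > 0" using neg by (simp add: l_def divide_pos_pos del: divide_minus_right minus_divide_right)
      moreover have "l * (n \<bullet> k) = - (\<bar>c\<bar> + 1)" using neg by (simp add: l_def)
      ultimately show False using scaled[OF k] by fastforce
    qed
    \<comment> \<open>A nonnegative functional is positive on an open set, as one can step in direction \<open>- n\<close>.\<close>
    have pos: "n \<bullet> k > 0" if k: "k \<in> K" for k
    proof -
      obtain r where r: "r > 0" "cball k r \<subseteq> K" using K(1) k open_contains_cball by blast
      have "k - (r / norm n) *\<^sub>R n \<in> cball k r" using r n(1) by (simp add: dist_norm)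
      then have "0 \<le> n \<bullet> (k - (r / norm n) *\<^sub>R n)" using r nonneg by blast
      also have "\<dots> = n \<bullet> k - r * norm n"
        using n(1) by (simp add: inner_diff_right power2_norm_eq_inner[symmetric] power2_eq_square)
      finally show ?thesis using r n(1) by (smt (verit) mult_pos_pos zero_less_norm_iff)
    qed
    have "c \<le> 0"
    proof (rule ccontr)
      assume c: "\<not> c \<le> 0"
      obtain k where k: "k \<in> K" using False by blast
      have "c / (2 * (n \<bullet> k)) > 0" using pos[OF k] c by simp
      from scaled[OF k this] have "c \<le> c / 2" using pos[OF k] by simp
      then show False using c by simp
    qed
    define g where "g t = n \<bullet> \<sigma> t" for t
    have intg: "((\<lambda>t. n \<bullet> d t) has_integral (g t - g s)) {s..t}" if "a \<le> s" "s \<le> t" "t \<le> b" for s t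
      using has_integral_linear[OF int[OF that] bounded_linear_inner_right[of n]]
      by (simp add: o_def g_def inner_diff_right)
    have "n \<bullet> d t \<ge> 0" for t
      using d0[of t] nonneg by (auto simp: d_def)
    then have mono: "g s \<le> g t" if "a \<le> s" "s \<le> t" "t \<le> b" for s t
      using has_integral_nonneg[OF intg[OF that]] by simp
    have "g b \<le> g a" using n(2) \<open>c \<le> 0\<close> by (simp add: g_def inner_diff_right)
    then have gconst: "g t = g a" if "t \<in> {a..b}" for t
      using mono[of a t] mono[of t b] that by simp
    show ?thesis
    proof (cases "t \<in> {a<..<b} - S")
      case True
      then have "(g has_vector_derivative n \<bullet> d t) (at t)"
        using bounded_linear.has_vector_derivative[OF bounded_linear_inner_right[of n], of \<sigma> "d0 t" "at t"] d0
        by (simp add: g_def[abs_def] d_def)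
      moreover have "(g has_vector_derivative 0) (at t)"
      proof (rule has_vector_derivative_transform_within_open)
        show "((\<lambda>_. g a) has_vector_derivative 0) (at t)" by (rule has_vector_derivative_const)
        show "g a = g s" if "s \<in> {a<..<b}" for s using gconst[of s] that by simp
      qed (use True in auto)
      ultimately have "n \<bullet> d t = 0" using vector_derivative_unique_at by blast
      then show ?thesis using d0[OF True] pos[of "d0 t"] True by (auto simp: d_def)
    qed (auto simp: d_def)
  qed
  have "\<sigma> t = \<sigma> a" if "t \<in> {a..b}" for t
  proof -
    have "(d has_integral 0) {a..t}" using d_zero by (intro has_integral_is_0) auto
    then show ?thesis using has_integral_unique[OF int[of a t]] that by fastforce
  qed
  then show ?thesis by blast
qed simp

section \<open>Uniform strict positivity\<close>

context homogeneous_cone_mfd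
begin

text \<open>Every unit vector \<open>u\<close> has a neighbourhood that is good uniformly in \<open>z\<close> near \<open>x0\<close> and \<open>q\<close> near \<open>f x0\<close>:
  if \<open>u\<close> lies in the cone at \<open>x0\<close>, its image is interior and stays so; otherwise vectors near \<open>u\<close> are
  outside all cones near \<open>x0\<close>. Compactness of the unit sphere leaves finitely many neighbourhoods
  to intersect, and positive scaling reaches all nonzero vectors.\<close>

lemma strict_positivity_uniform:
  fixes D :: "'g set \<Rightarrow> 'n \<Rightarrow> 'n"
  assumes x0: "\<kappa>0 \<in> charts_at M x0" and p: "\<kappa> \<in> charts_at M (f x0)"
    and W0: "openin (mtop M) W0" "x0 \<in> W0"
    and der: "\<And>z. z \<in> W0 \<Longrightarrow> ((snd \<kappa> \<circ> f \<circ> chart_inv \<kappa>0) has_derivative D z) (at (snd \<kappa>0 z))"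
    and cont: "\<And>v. continuous_map (subtopology (mtop M) W0) euclidean (\<lambda>z. D z v)"
    and pos: "differential M M f x0 ` (C x0 - {\<lambda>\<kappa>. 0}) \<subseteq> cone_interior M C (f x0)"
  obtains W U where "openin (mtop M) W" "x0 \<in> W" "W \<subseteq> W0"
    "openin (mtop M) U" "f x0 \<in> U" "U \<subseteq> fst \<kappa>"
    "\<And>z v q. \<lbrakk>z \<in> W; v \<in> coord_cone C \<kappa>0 z; v \<noteq> 0; q \<in> U; z \<in> fst \<kappa>0\<rbrakk> \<Longrightarrow> D z v \<in> interior (coord_cone C \<kappa> q)"
proof -
  have lin: "linear (D z)" if "z \<in> W0" for z using der[OF that] has_derivative_linear by blast
  have x0top: "x0 \<in> topspace (mtop M)" using W0 openin_subset by blast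
  have local: "\<exists>N W U. open N \<and> u \<in> N \<and> openin (mtop M) W \<and> x0 \<in> W \<and> openin (mtop M) U \<and> f x0 \<in> U \<and>
      (\<forall>u'\<in>N. \<forall>z\<in>W. \<forall>q\<in>U. z \<in> fst \<kappa>0 \<longrightarrow> u' \<in> coord_cone C \<kappa>0 z \<longrightarrow> D z u' \<in> interior (coord_cone C \<kappa> q))"
    (is "\<exists>N W U. ?P N W U") if u: "norm u = 1" for u
  proof (cases "u \<in> coord_cone C \<kappa>0 x0")
    case True
    let ?u = "coord_vector M \<kappa>0 x0 u"
    have uC: "?u \<in> C x0" using True coord_cone_iff[OF x0] by simp
    have "?u \<noteq> (\<lambda>\<kappa>. 0)" using coord_vector_coord[OF x0, of u] u by fastforce
    then have int: "differential M M f x0 ?u \<in> cone_interior M C (f x0)" using pos uC by blast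
    have "differential M M f x0 ?u \<kappa> = D x0 u"
      using differential_coord[OF x0 p _ der[OF W0(2)], of ?u] coord_vector_tangent[OF x0] x0 by simp
    moreover have "differential M M f x0 ?u \<in> tangent_space M (f x0)"
      using int interior_of_subset_topspace unfolding cone_interior_def by fastforce
    ultimately have "coord_vector M \<kappa> (f x0) (D x0 u) \<in> cone_interior M C (f x0)"
      using coord_vector_of_tangent[OF p] int by metis
    then have "D x0 u \<in> interior (coord_cone C \<kappa> (f x0))"
      using coord_cone_interior_iff[OF p] by blast
    then obtain U \<delta> where U: "openin (mtop M) U" "f x0 \<in> U" "\<delta> > 0"
      and U\<delta>: "\<And>q v. \<lbrakk>q \<in> U; v \<in> ball (D x0 u) \<delta>\<rbrakk> \<Longrightarrow> v \<in> interior (coord_cone C \<kappa> q)"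
      using interior_coord_cone_nbhd[OF p] by metis
    obtain W where W: "openin (mtop M) W" "x0 \<in> W" "W \<subseteq> W0"
      and WD: "\<And>z v. z \<in> W \<Longrightarrow> norm (D z v - D x0 v) \<le> \<delta> / 4 * norm v"
      using linear_family_near[OF W0 lin cont, of "\<delta> / 4"] U(3) by (metis divide_pos_pos zero_less_numeral)
    have "continuous_on UNIV (D x0)"
      using lin[OF W0(2)] linear_conv_bounded_linear linear_continuous_on by blast
    then have "open (D x0 -` ball (D x0 u) (\<delta> / 2))" by (intro open_vimage) auto
    then have "open (ball 0 2 \<inter> D x0 -` ball (D x0 u) (\<delta> / 2))" by blast
    moreover have "D z u' \<in> ball (D x0 u) \<delta>"
      if "u' \<in> ball 0 2 \<inter> D x0 -` ball (D x0 u) (\<delta> / 2)" "z \<in> W" for u' z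
    proof -
      have "dist (D x0 u) (D x0 u') < \<delta> / 2" "norm u' < 2" using that by auto
      moreover have "norm (D z u' - D x0 u') < \<delta> / 2"
      proof -
        have "\<delta> / 4 * norm u' < \<delta> / 4 * 2"
          using \<open>norm u' < 2\<close> U(3) by (intro mult_strict_left_mono) auto
        then show ?thesis using WD[OF that(2), of u'] by simp
      qed
      ultimately show ?thesis
        using dist_triangle[of "D x0 u" "D z u'" "D x0 u'"] by (simp add: dist_norm norm_minus_commute)
    qed
    ultimately have "?P (ball 0 2 \<inter> D x0 -` ball (D x0 u) (\<delta> / 2)) W U"
      using U W U\<delta> u by simp
    then show ?thesis by blast
  next
    case False
    obtain W \<delta> where "openin (mtop M) W" "x0 \<in> W" "\<delta> > 0"
      "\<And>q v. \<lbrakk>q \<in> W; v \<in> ball u \<delta>\<rbrakk> \<Longrightarrow> v \<notin> coord_cone C \<kappa>0 q"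
      using not_in_coord_cone_nbhd[OF x0 False] by metis
    moreover have "openin (mtop M) (fst \<kappa>)" "f x0 \<in> fst \<kappa>" using p charts_atD chart(1) by blast+
    ultimately have "?P (ball u \<delta>) W (fst \<kappa>)" by auto
    then show ?thesis by blast
  qed
  then obtain N W U where P: "\<And>u. norm u = 1 \<Longrightarrow> open (N u) \<and> u \<in> N u \<and> openin (mtop M) (W u) \<and> x0 \<in> W u \<and>
      openin (mtop M) (U u) \<and> f x0 \<in> U u \<and>
      (\<forall>u'\<in>N u. \<forall>z\<in>W u. \<forall>q\<in>U u. z \<in> fst \<kappa>0 \<longrightarrow> u' \<in> coord_cone C \<kappa>0 z \<longrightarrow> D z u' \<in> interior (coord_cone C \<kappa> q))"
    by metis
  obtain S where S: "S \<subseteq> sphere 0 1" "finite S" "sphere 0 1 \<subseteq> (\<Union>u\<in>S. N u)"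
    using compactE_image[OF compact_sphere, of "sphere 0 1" N 0 1] P by (metis (no_types, lifting) UN_I dist_0_norm mem_sphere subsetI)
  let ?W = "W0 \<inter> ((\<Inter>u\<in>S. W u) \<inter> topspace (mtop M))"
  let ?U = "fst \<kappa> \<inter> ((\<Inter>u\<in>S. U u) \<inter> topspace (mtop M))"
  have S1: "norm u = 1" if "u \<in> S" for u using S that by auto
  show thesis
  proof
    show "openin (mtop M) ?W" using P S1 S(2) W0 by (intro openin_Int openin_INT) auto
    show "openin (mtop M) ?U" using P S1 S(2) p charts_atD chart(1) by (intro openin_Int openin_INT) auto
    show "x0 \<in> ?W" using W0 x0top P S1 by blast
    show "f x0 \<in> ?U" using p charts_atD chart_subset P S1 by blast
    show "?W \<subseteq> W0" "?U \<subseteq> fst \<kappa>" by auto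
    fix z v q assume z: "z \<in> ?W" "z \<in> fst \<kappa>0" and v: "v \<in> coord_cone C \<kappa>0 z" "v \<noteq> 0" and q: "q \<in> ?U"
    have \<kappa>z: "\<kappa>0 \<in> charts_at M z" using x0 z by (simp add: charts_at_def)
    have \<kappa>q: "\<kappa> \<in> charts_at M q" using p q by (simp add: charts_at_def)
    define u where "u = (1 / norm v) *\<^sub>R v"
    have u: "u \<in> coord_cone C \<kappa>0 z" using coord_cone_scale[OF \<kappa>z v(1), of "1 / norm v"] by (simp add: u_def)
    have "norm u = 1" using v(2) by (simp add: u_def)
    then obtain u0 where u0: "u0 \<in> S" "u \<in> N u0" using S(3) by auto
    then have "D z u \<in> interior (coord_cone C \<kappa> q)" using P[OF S1[OF u0(1)]] z q u by blast
    then have "norm v *\<^sub>R D z u \<in> interior (coord_cone C \<kappa> q)"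
      using coord_cone_interior_scale[OF \<kappa>q] v(2) by simp
    moreover have "norm v *\<^sub>R D z u = D z v"
      using lin[of z] z v(2) by (simp add: u_def linear_scale)
    ultimately show "D z v \<in> interior (coord_cone C \<kappa> q)" by simp
  qed
qed

end

section \<open>Operations on conal curves\<close>

lemma has_vector_derivative_shift:
  fixes f :: "real \<Rightarrow> 'e::real_normed_vector"
  assumes "(f has_vector_derivative d) (at (t + k) within (\<lambda>s. s + k) ` S)"
  shows "((\<lambda>s. f (s + k)) has_vector_derivative d) (at t within S)"
proof -
  have "((\<lambda>s. s + k) has_vector_derivative 1) (at t within S)"
    by (auto intro!: derivative_eq_intros)
  from vector_diff_chain_within[OF this, of f d] assms show ?thesis by (simp add: o_def)
qed

lemma image_add_atLeast_real: "(\<lambda>s. s + k) ` {t..} = {t + k..}" for k t :: real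
proof (intro equalityI subsetI)
  fix x assume "x \<in> {t + k..}"
  then show "x \<in> (\<lambda>s. s + k) ` {t..}" by (intro image_eqI[of _ _ "x - k"]) auto
qed auto

lemma image_add_atLeastAtMost_real: "(\<lambda>s. s + k) ` {a..b} = {a + k..b + k}" for k a b :: real
proof (intro equalityI subsetI)
  fix x assume "x \<in> {a + k..b + k}"
  then show "x \<in> (\<lambda>s. s + k) ` {a..b}" by (intro image_eqI[of _ _ "x - k"]) auto
qed auto

text \<open>The right-hand derivative is taken within \<open>{t..}\<close> in the proofs below, because the transformation
  rules for derivatives require the point to belong to the set.\<close>

lemma vector_derivative_right_shift:
  fixes f :: "real \<Rightarrow> 'e::real_normed_vector"
  shows "vector_derivative (\<lambda>s. f (s + k)) (at_right t) = vector_derivative f (at_right (t + k))"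
proof -
  have "((\<lambda>s. f (s + k)) has_vector_derivative d) (at t within {t..}) \<longleftrightarrow>
      (f has_vector_derivative d) (at (t + k) within {t + k..})" for d
    using has_vector_derivative_shift[of f d t k "{t..}"]
      has_vector_derivative_shift[of "\<lambda>s. f (s + k)" d "t + k" "- k" "{t + k..}"]
      image_add_atLeast_real[of k t] image_add_atLeast_real[of "- k" "t + k"] by auto
  then show ?thesis by (simp add: vector_derivative_def at_within_Ici_at_right)
qed

lemma vector_derivative_right_cong:
  fixes f :: "real \<Rightarrow> 'e::real_normed_vector"
  assumes "t < b" "\<And>s. s \<in> {t..<b} \<Longrightarrow> f s = g s"
  shows "vector_derivative f (at_right t) = vector_derivative g (at_right t)"
proof -
  have "eventually (\<lambda>s. s < b) (nhds t)" using assms(1) by (rule order_tendstoD(2)[OF filterlim_ident])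
  then have "eventually (\<lambda>s. s \<in> {t..} \<longrightarrow> f s = g s) (nhds t)"
    by eventually_elim (use assms(2) in auto)
  from vector_derivative_cong_eq[OF this refl refl]
  show ?thesis by (simp add: at_within_Ici_at_right)
qed

lemma C1_curve_on_cong:
  assumes "C1_curve_on M \<gamma> a b" "\<And>t. t \<in> {a..b} \<Longrightarrow> \<gamma>' t = \<gamma> t"
  shows "C1_curve_on M \<gamma>' a b"
proof -
  obtain v where v: "\<And>\<kappa>. \<kappa> \<in> atlas M \<Longrightarrow>
     (\<forall>t\<in>{a..b}. \<gamma> t \<in> fst \<kappa> \<longrightarrow>
        ((snd \<kappa> \<circ> \<gamma>) has_vector_derivative v t \<kappa>) (at t within {a..b})) \<and>
     continuous_on {t \<in> {a..b}. \<gamma> t \<in> fst \<kappa>} (\<lambda>t. v t \<kappa>)"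
    using assms(1) unfolding C1_curve_on_def by blast
  have "((snd \<kappa> \<circ> \<gamma>') has_vector_derivative v t \<kappa>) (at t within {a..b})"
    if "\<kappa> \<in> atlas M" "t \<in> {a..b}" "\<gamma>' t \<in> fst \<kappa>" for \<kappa> t
    by (rule has_vector_derivative_transform[of _ _ _ "snd \<kappa> \<circ> \<gamma>"]) (use that v assms(2) in auto)
  moreover have "{t \<in> {a..b}. \<gamma>' t \<in> fst \<kappa>} = {t \<in> {a..b}. \<gamma> t \<in> fst \<kappa>}"
    if "\<kappa> \<in> atlas M" for \<kappa>
    using assms(2) by auto
  moreover have "continuous_on {t \<in> {a..b}. \<gamma> t \<in> fst \<kappa>} (\<lambda>t. v t \<kappa>)" if "\<kappa> \<in> atlas M" for \<kappa>
    using v[OF that] by blast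
  ultimately show ?thesis
    unfolding C1_curve_on_def by (intro exI[of _ v] ballI conjI impI) simp_all
qed

lemma C1_curve_on_shift:
  assumes "C1_curve_on M \<gamma> (a + k) (b + k)"
  shows "C1_curve_on M (\<lambda>t. \<gamma> (t + k)) a b"
proof -
  obtain v where v: "\<And>\<kappa>. \<kappa> \<in> atlas M \<Longrightarrow>
     (\<forall>t\<in>{a+k..b+k}. \<gamma> t \<in> fst \<kappa> \<longrightarrow>
        ((snd \<kappa> \<circ> \<gamma>) has_vector_derivative v t \<kappa>) (at t within {a+k..b+k})) \<and>
     continuous_on {t \<in> {a+k..b+k}. \<gamma> t \<in> fst \<kappa>} (\<lambda>t. v t \<kappa>)"
    using assms unfolding C1_curve_on_def by blast
  have "((snd \<kappa> \<circ> (\<lambda>t. \<gamma> (t + k))) has_vector_derivative v (t + k) \<kappa>) (at t within {a..b})"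
    if "\<kappa> \<in> atlas M" "t \<in> {a..b}" "\<gamma> (t + k) \<in> fst \<kappa>" for \<kappa> t
    using has_vector_derivative_shift[of "snd \<kappa> \<circ> \<gamma>" "v (t + k) \<kappa>" t k "{a..b}"] v that
    by (simp add: image_add_atLeastAtMost_real o_def)
  moreover have "continuous_on {t \<in> {a..b}. \<gamma> (t + k) \<in> fst \<kappa>} (\<lambda>t. v (t + k) \<kappa>)"
    if "\<kappa> \<in> atlas M" for \<kappa>
  proof -
    have "continuous_on {t \<in> {a..b}. \<gamma> (t + k) \<in> fst \<kappa>} (\<lambda>t. t + k)"
      by (intro continuous_intros)
    moreover have "(\<lambda>t. t + k) ` {t \<in> {a..b}. \<gamma> (t + k) \<in> fst \<kappa>} \<subseteq> {t \<in> {a+k..b+k}. \<gamma> t \<in> fst \<kappa>}"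
      by auto
    ultimately show ?thesis
      using continuous_on_compose2[of _ "\<lambda>t. v t \<kappa>"] v[OF that] by blast
  qed
  ultimately show ?thesis
    unfolding C1_curve_on_def by (intro exI[of _ "\<lambda>t. v (t + k)"]) simp
qed

lemma curve_derivative_shift:
  "curve_derivative M (\<lambda>s. \<gamma> (s + k)) t = curve_derivative M \<gamma> (t + k)"
proof -
  have "vector_derivative (snd \<kappa> \<circ> (\<lambda>s. \<gamma> (s + k))) (at_right t) =
      vector_derivative (snd \<kappa> \<circ> \<gamma>) (at_right (t + k))" for \<kappa> :: "('a, 'b) chart"
    using vector_derivative_right_shift[of "snd \<kappa> \<circ> \<gamma>" k t] by (simp add: o_def)
  then show ?thesis unfolding curve_derivative_def by (simp only:)
qed

lemma curve_derivative_cong: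
  assumes "t < b" "\<And>s. s \<in> {t..<b} \<Longrightarrow> \<gamma>' s = \<gamma> s"
  shows "curve_derivative M \<gamma>' t = curve_derivative M \<gamma> t"
proof -
  have "vector_derivative (snd \<kappa> \<circ> \<gamma>') (at_right t) = vector_derivative (snd \<kappa> \<circ> \<gamma>) (at_right t)"
    for \<kappa> :: "('a, 'b) chart"
    by (rule vector_derivative_right_cong[OF assms(1)]) (simp add: assms(2))
  moreover have "\<gamma>' t = \<gamma> t" using assms by simp
  ultimately show ?thesis unfolding curve_derivative_def by (simp only:)
qed

lemma piecewise_C1_curveE:
  assumes "piecewise_C1_curve M \<gamma> t0 t1"
  obtains P where "finite P" "{t0, t1} \<subseteq> P" "P \<subseteq> {t0..t1}"
    "\<forall>s t. s \<in> P \<longrightarrow> t \<in> P \<longrightarrow> s < t \<longrightarrow> {s<..<t} \<inter> P = {} \<longrightarrow> C1_curve_on M \<gamma> s t"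
proof -
  obtain P where P: "finite P \<and> {t0, t1} \<subseteq> P \<and> P \<subseteq> {t0..t1} \<and>
      (\<forall>a\<in>P. \<forall>b\<in>P. a < b \<and> {a<..<b} \<inter> P = {} \<longrightarrow> C1_curve_on M \<gamma> a b)"
    using assms unfolding piecewise_C1_curve_def by (elim conjE exE) (rule that, intro conjI)
  show thesis by (rule that[of P]) (use P in \<open>simp_all\<close>)
qed

lemma piecewise_C1_curveI:
  assumes "continuous_map (top_of_set {t0..t1}) (mtop M) \<gamma>"
    "finite P" "{t0, t1} \<subseteq> P" "P \<subseteq> {t0..t1}"
    "\<And>s t. s \<in> P \<Longrightarrow> t \<in> P \<Longrightarrow> s < t \<Longrightarrow> {s<..<t} \<inter> P = {} \<Longrightarrow> C1_curve_on M \<gamma> s t"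
  shows "piecewise_C1_curve M \<gamma> t0 t1"
  unfolding piecewise_C1_curve_def
proof (intro conjI exI[of _ P])
  show "\<forall>a\<in>P. \<forall>b\<in>P. a < b \<and> {a<..<b} \<inter> P = {} \<longrightarrow> C1_curve_on M \<gamma> a b"
    using assms(5) by simp
qed (fact assms)+

lemma conal_curveD:
  assumes "conal_curve M C \<gamma> t0 t1"
  shows "t0 < t1" "piecewise_C1_curve M \<gamma> t0 t1" "continuous_map (top_of_set {t0..t1}) (mtop M) \<gamma>"
  using assms by (simp_all add: conal_curve_def piecewise_C1_curve_def)

lemma strictly_conal_curveD: "strictly_conal_curve M C \<gamma> t0 t1 \<Longrightarrow> conal_curve M C \<gamma> t0 t1"
  by (simp add: strictly_conal_curve_def)

lemma strictly_conal_curve_shift: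
  assumes "strictly_conal_curve M C \<gamma> (a + k) (b + k)"
  shows "strictly_conal_curve M C (\<lambda>t. \<gamma> (t + k)) a b"
proof -
  have ab: "a < b" using assms by (simp add: strictly_conal_curve_def conal_curve_def)
  obtain P where P: "finite P" "{a + k, b + k} \<subseteq> P" "P \<subseteq> {a + k..b + k}"
    "\<forall>s t. s \<in> P \<longrightarrow> t \<in> P \<longrightarrow> s < t \<longrightarrow> {s<..<t} \<inter> P = {} \<longrightarrow> C1_curve_on M \<gamma> s t"
    by (rule piecewise_C1_curveE[OF conal_curveD(2)[OF strictly_conal_curveD[OF assms]]])
  note cont = conal_curveD(3)[OF strictly_conal_curveD[OF assms]]
  define Q where "Q = (\<lambda>t. t - k) ` P"
  have Q: "t \<in> Q \<longleftrightarrow> t + k \<in> P" for t by (force simp: Q_def)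
  have "continuous_map (top_of_set {a..b}) (top_of_set {a + k..b + k}) (\<lambda>t. t + k)"
    by (auto intro!: continuous_intros)
  from continuous_map_compose[OF this cont]
  have "continuous_map (top_of_set {a..b}) (mtop M) (\<lambda>t. \<gamma> (t + k))" by (simp add: o_def)
  moreover have "finite Q" using P(1) by (simp add: Q_def)
  moreover have "{a, b} \<subseteq> Q" using P(2) by (auto simp: Q)
  moreover have "Q \<subseteq> {a..b}" using P(3) by (auto simp: Q_def)
  moreover have "C1_curve_on M (\<lambda>t. \<gamma> (t + k)) s t" if "s \<in> Q" "t \<in> Q" "s < t" "{s<..<t} \<inter> Q = {}" for s t
  proof (rule C1_curve_on_shift[OF P(4)[rule_format]])
    show "s + k \<in> P" "t + k \<in> P" "s + k < t + k" using that by (auto simp: Q)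
    show "{s + k<..<t + k} \<inter> P = {}"
    proof (rule ccontr)
      assume "{s + k<..<t + k} \<inter> P \<noteq> {}"
      then obtain r where "r \<in> P" "s + k < r" "r < t + k" by auto
      then have "r - k \<in> {s<..<t} \<inter> Q" by (auto simp: Q)
      then show False using that by blast
    qed
  qed
  ultimately have "piecewise_C1_curve M (\<lambda>t. \<gamma> (t + k)) a b"
    by (rule piecewise_C1_curveI)
  then show ?thesis
    using assms ab unfolding strictly_conal_curve_def conal_curve_def curve_derivative_shift by simp
qed

lemma strictly_conal_curve_join:
  assumes 1: "strictly_conal_curve M C \<gamma>1 a b" and 2: "strictly_conal_curve M C \<gamma>2 b c"
    and eq: "\<gamma>1 b = \<gamma>2 b"
  shows "strictly_conal_curve M C (\<lambda>t. if t \<le> b then \<gamma>1 t else \<gamma>2 t) a c"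
proof -
  let ?\<gamma> = "\<lambda>t. if t \<le> b then \<gamma>1 t else \<gamma>2 t"
  have ab: "a < b" "b < c" using 1 2 by (auto simp: strictly_conal_curve_def conal_curve_def)
  have g2: "?\<gamma> t = \<gamma>2 t" if "b \<le> t" for t using eq that by (cases "t = b") auto
  obtain P1 where P1: "finite P1" "{a, b} \<subseteq> P1" "P1 \<subseteq> {a..b}"
    "\<forall>s t. s \<in> P1 \<longrightarrow> t \<in> P1 \<longrightarrow> s < t \<longrightarrow> {s<..<t} \<inter> P1 = {} \<longrightarrow> C1_curve_on M \<gamma>1 s t"
    by (rule piecewise_C1_curveE[OF conal_curveD(2)[OF strictly_conal_curveD[OF 1]]])
  note cont1 = conal_curveD(3)[OF strictly_conal_curveD[OF 1]]
  obtain P2 where P2: "finite P2" "{b, c} \<subseteq> P2" "P2 \<subseteq> {b..c}"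
    "\<forall>s t. s \<in> P2 \<longrightarrow> t \<in> P2 \<longrightarrow> s < t \<longrightarrow> {s<..<t} \<inter> P2 = {} \<longrightarrow> C1_curve_on M \<gamma>2 s t"
    by (rule piecewise_C1_curveE[OF conal_curveD(2)[OF strictly_conal_curveD[OF 2]]])
  note cont2 = conal_curveD(3)[OF strictly_conal_curveD[OF 2]]
  have "continuous_map (top_of_set {a..c}) (mtop M) ?\<gamma>"
  proof (rule continuous_map_cases_le)
    have "{a..c} \<inter> {t. a \<le> t \<and> t \<le> c \<and> t \<le> b} = {a..b}" "{a..c} \<inter> {t. a \<le> t \<and> t \<le> c \<and> b \<le> t} = {b..c}"
      using ab by auto
    then show "continuous_map (subtopology (top_of_set {a..c}) {t. t \<in> topspace (top_of_set {a..c}) \<and> t \<le> b}) (mtop M) \<gamma>1"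
      "continuous_map (subtopology (top_of_set {a..c}) {t. t \<in> topspace (top_of_set {a..c}) \<and> b \<le> t}) (mtop M) \<gamma>2"
      using cont1 cont2 by (simp_all add: subtopology_subtopology)
  qed (use eq in \<open>auto intro!: continuous_intros\<close>)
  moreover have "finite (P1 \<union> P2)" "{a, c} \<subseteq> P1 \<union> P2" "P1 \<union> P2 \<subseteq> {a..c}"
    using P1 P2 ab by auto
  moreover have "C1_curve_on M ?\<gamma> s t"
    if "s \<in> P1 \<union> P2" "t \<in> P1 \<union> P2" "s < t" "{s<..<t} \<inter> (P1 \<union> P2) = {}" for s t
  proof (cases "t \<le> b")
    case True
    then have "s \<in> P1" "t \<in> P1" using that P1(2,3) P2(3) by force+
    then have "C1_curve_on M \<gamma>1 s t" using that by (intro P1(4)[rule_format]) auto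
    then show ?thesis by (rule C1_curve_on_cong) (use True in auto)
  next
    case False
    have "b \<notin> {s<..<t}" using that P1(2) by blast
    then have "b \<le> s" using False by auto
    then have "s \<in> P2" "t \<in> P2" using that False P1(3) P2(2) by force+
    then have "C1_curve_on M \<gamma>2 s t" using that by (intro P2(4)[rule_format]) auto
    then show ?thesis by (rule C1_curve_on_cong) (rule g2, use \<open>b \<le> s\<close> in auto)
  qed
  ultimately have pw: "piecewise_C1_curve M ?\<gamma> a c"
    by (rule piecewise_C1_curveI)
  have der: "curve_derivative M ?\<gamma> t \<in> C (?\<gamma> t) \<and> curve_derivative M ?\<gamma> t \<in> cone_interior M C (?\<gamma> t)"
    if "a \<le> t" "t < c" for t
  proof (cases "t < b")
    case True
    then have "curve_derivative M ?\<gamma> t = curve_derivative M \<gamma>1 t"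
      by (intro curve_derivative_cong[of t b]) auto
    then show ?thesis using 1 True that by (simp add: strictly_conal_curve_def conal_curve_def)
  next
    case False
    have "curve_derivative M ?\<gamma> t = curve_derivative M \<gamma>2 t"
      by (rule curve_derivative_cong[OF that(2)]) (rule g2, use False in auto)
    then show ?thesis using 2 False that g2[of t] by (simp add: strictly_conal_curve_def conal_curve_def)
  qed
  show ?thesis
    using pw der ab unfolding strictly_conal_curve_def conal_curve_def by auto
qed

lemma conal_ll_trans:
  assumes "conal_ll M C x y" "conal_ll M C y z"
  shows "conal_ll M C x z"
proof -
  obtain \<gamma>1 a b where 1: "strictly_conal_curve M C \<gamma>1 a b" "\<gamma>1 a = x" "\<gamma>1 b = y"
    using assms(1) by (auto simp: conal_ll_def)
  obtain \<gamma>2 c d where 2: "strictly_conal_curve M C \<gamma>2 c d" "\<gamma>2 c = y" "\<gamma>2 d = z"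
    using assms(2) by (auto simp: conal_ll_def)
  have lt: "a < b" "c < d" using 1 2 by (auto simp: strictly_conal_curve_def conal_curve_def)
  define k where "k = c - b"
  have "strictly_conal_curve M C (\<lambda>t. \<gamma>2 (t + k)) b (d - k)"
    using 2(1) by (intro strictly_conal_curve_shift) (simp add: k_def)
  from strictly_conal_curve_join[OF 1(1) this] 
  have "strictly_conal_curve M C (\<lambda>t. if t \<le> b then \<gamma>1 t else \<gamma>2 (t + k)) a (d - k)"
    using 1 2 by (simp add: k_def)
  moreover have "\<not> d - k \<le> b" using lt by (simp add: k_def)
  ultimately show ?thesis
    unfolding conal_ll_def using 1 2 lt
    by (intro exI[of _ "\<lambda>t. if t \<le> b then \<gamma>1 t else \<gamma>2 (t + k)"] exI[of _ a] exI[of _ "d - k"]) auto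
qed

context cone_mfd
begin

text \<open>Away from the break points the right-hand derivative in the definition of a conal curve is a
  two-sided one, to which the chain rule applies.\<close>

lemma conal_curve_chart_derivative:
  assumes "conal_curve M C \<gamma> t0 t1"
  obtains P where "finite P"
    "\<And>t \<kappa>. \<lbrakk>t \<in> {t0<..<t1} - P; \<kappa> \<in> charts_at M (\<gamma> t)\<rbrakk> \<Longrightarrow>
       \<exists>d\<in>coord_cone C \<kappa> (\<gamma> t). ((snd \<kappa> \<circ> \<gamma>) has_vector_derivative d) (at t)"
proof -
  obtain P where P: "finite P" "{t0, t1} \<subseteq> P" "P \<subseteq> {t0..t1}"
    "\<forall>s t. s \<in> P \<longrightarrow> t \<in> P \<longrightarrow> s < t \<longrightarrow> {s<..<t} \<inter> P = {} \<longrightarrow> C1_curve_on M \<gamma> s t"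
    by (rule piecewise_C1_curveE[OF conal_curveD(2)[OF assms]])
  show thesis
  proof
    fix t \<kappa> assume t: "t \<in> {t0<..<t1} - P" and \<kappa>: "\<kappa> \<in> charts_at M (\<gamma> t)"
    let ?A = "{p \<in> P. p < t}" and ?B = "{p \<in> P. t < p}"
    define a b where "a = Max ?A" and "b = Min ?B"
    have fin: "finite ?A" "?A \<noteq> {}" "finite ?B" "?B \<noteq> {}" using P t by auto
    have a: "a \<in> P" "a < t" using Max_in[OF fin(1,2)] by (auto simp: a_def)
    have b: "b \<in> P" "t < b" using Min_in[OF fin(3,4)] by (auto simp: b_def)
    have "{a<..<b} \<inter> P = {}"
    proof (rule ccontr)
      assume "{a<..<b} \<inter> P \<noteq> {}"
      then obtain r where r: "r \<in> P" "a < r" "r < b" by auto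
      then have "r \<noteq> t" using t by auto
      then consider "r < t" | "t < r" by linarith
      then show False
      proof cases
        case 1
        then have "r \<le> a" unfolding a_def using r fin by (intro Max_ge) auto
        then show False using r by simp
      next
        case 2
        then have "b \<le> r" unfolding b_def using r fin by (intro Min_le) auto
        then show False using r by simp
      qed
    qed
    then have "C1_curve_on M \<gamma> a b" using P(4)[rule_format] a b by auto
    then obtain d where "((snd \<kappa> \<circ> \<gamma>) has_vector_derivative d) (at t within {a..b})"
      using \<kappa> a b charts_atD unfolding C1_curve_on_def by (meson atLeastAtMost_iff less_imp_le)
    then have d: "((snd \<kappa> \<circ> \<gamma>) has_vector_derivative d) (at t)"
      using a b by (simp add: at_within_Icc_at)
    then have "((snd \<kappa> \<circ> \<gamma>) has_vector_derivative d) (at_right t)"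
      by (rule has_vector_derivative_at_within)
    then have "vector_derivative (snd \<kappa> \<circ> \<gamma>) (at_right t) = d"
      by (intro vector_derivative_within) (auto simp: trivial_limit_at_right_real)
    then have "curve_derivative M \<gamma> t \<kappa> = d" using \<kappa> by (simp add: curve_derivative_def)
    moreover have "curve_derivative M \<gamma> t \<in> C (\<gamma> t)" using assms t by (simp add: conal_curve_def)
    ultimately have "d \<in> coord_cone C \<kappa> (\<gamma> t)" unfolding coord_cone_def by blast
    then show "\<exists>d\<in>coord_cone C \<kappa> (\<gamma> t). ((snd \<kappa> \<circ> \<gamma>) has_vector_derivative d) (at t)" using d by blast
  qed (rule P(1))
qed

lemma conal_curve_in_space:
  "conal_curve M C \<gamma> t0 t1 \<Longrightarrow> t \<in> {t0..t1} \<Longrightarrow> \<gamma> t \<in> topspace (mtop M)"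
  using continuous_map_image_subset_topspace[OF conal_curveD(3)] by fastforce

text \<open>The derivative of a constant curve is \<open>0\<close>, which is not an interior point of a pointed cone.\<close>

lemma strictly_conal_curve_not_constant:
  assumes "strictly_conal_curve M C \<gamma> t0 t1"
  obtains t where "t \<in> {t0..t1}" "\<gamma> t \<noteq> \<gamma> t0"
proof (rule ccontr)
  assume "\<not> thesis"
  with that have const: "\<And>t. t \<in> {t0..t1} \<Longrightarrow> \<gamma> t = \<gamma> t0" by blast
  have lt: "t0 < t1" and int: "curve_derivative M \<gamma> t0 \<in> cone_interior M C (\<gamma> t0)" and con: "conal_curve M C \<gamma> t0 t1"
    using assms by (auto simp: strictly_conal_curve_def conal_curve_def)
  have "\<gamma> t0 \<in> topspace (mtop M)" using conal_curve_in_space[OF con] lt by simp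
  then obtain \<kappa> where \<kappa>: "\<kappa> \<in> charts_at M (\<gamma> t0)" using ex_chart by blast
  have "curve_derivative M \<gamma> t0 = curve_derivative M (\<lambda>t. \<gamma> t0) t0"
    by (rule curve_derivative_cong[OF lt]) (rule const, simp)
  also have "\<dots> = coord_vector M \<kappa> (\<gamma> t0) 0"
  proof
    fix \<kappa>'
    have "vector_derivative (\<lambda>t. c) (at_right t0) = 0" for c :: 'e
      by (intro vector_derivative_within) (auto simp: trivial_limit_at_right_real)
    then show "curve_derivative M (\<lambda>t. \<gamma> t0) t0 \<kappa>' = coord_vector M \<kappa> (\<gamma> t0) 0 \<kappa>'"
      using linear_trans_deriv[OF \<kappa>]
      by (simp add: curve_derivative_def coord_vector_alt o_def linear_0)
  qed
  finally have "curve_derivative M \<gamma> t0 = coord_vector M \<kappa> (\<gamma> t0) 0" .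
  with int have "coord_vector M \<kappa> (\<gamma> t0) 0 \<in> cone_interior M C (\<gamma> t0)" by (simp only:)
  then have "0 \<in> interior (coord_cone C \<kappa> (\<gamma> t0))" using coord_cone_interior_iff[OF \<kappa>] by blast
  then show False using coord_cone_interior_nonzero[OF \<kappa>] by simp
qed

text \<open>The velocity of a chart segment is the constant coordinate vector \<open>w\<close>, so strict conality is a
  condition on the cones along the segment only.\<close>

lemma chart_segment_conal_ll:
  assumes \<kappa>: "\<kappa> \<in> atlas M"
    and seg: "\<And>\<tau>. \<tau> \<in> {0..1} \<Longrightarrow> u + \<tau> *\<^sub>R w \<in> snd \<kappa> ` fst \<kappa>"
    and w: "\<And>\<tau>. \<tau> \<in> {0..1} \<Longrightarrow> w \<in> interior (coord_cone C \<kappa> (chart_inv \<kappa> (u + \<tau> *\<^sub>R w)))"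
  shows "conal_ll M C (chart_inv \<kappa> u) (chart_inv \<kappa> (u + w))"
proof -
  define \<gamma> where "\<gamma> \<tau> = chart_inv \<kappa> (u + \<tau> *\<^sub>R w)" for \<tau>
  have \<gamma>\<kappa>: "\<kappa> \<in> charts_at M (\<gamma> \<tau>)" "snd \<kappa> (\<gamma> \<tau>) = u + \<tau> *\<^sub>R w" if "\<tau> \<in> {0..1}" for \<tau>
    using seg[OF that] \<kappa> by (auto simp: \<gamma>_def charts_at_def)
  have der: "((snd \<kappa>' \<circ> \<gamma>) has_vector_derivative trans_deriv \<kappa> \<kappa>' (\<gamma> \<tau>) w) (at \<tau>)"
    if \<tau>: "\<tau> \<in> {0..1}" and \<kappa>': "\<kappa>' \<in> charts_at M (\<gamma> \<tau>)" for \<tau> \<kappa>'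
  proof -
    have 1: "((\<lambda>\<tau>. u + \<tau> *\<^sub>R w) has_derivative (\<lambda>h. h *\<^sub>R w)) (at \<tau>)"
      by (auto intro!: derivative_eq_intros)
    have "((snd \<kappa>' \<circ> chart_inv \<kappa>) has_derivative trans_deriv \<kappa> \<kappa>' (\<gamma> \<tau>)) (at (u + \<tau> *\<^sub>R w))"
      using trans_deriv[OF \<gamma>\<kappa>(1)[OF \<tau>] \<kappa>'] \<gamma>\<kappa>(2)[OF \<tau>] by simp
    from diff_chain_at[OF 1 this] show ?thesis
      using linear_trans_deriv[OF \<gamma>\<kappa>(1)[OF \<tau>] \<kappa>']
      by (simp add: has_vector_derivative_def o_def \<gamma>_def linear_scale)
  qed
  have "continuous_map (top_of_set {0..1}) (top_of_set (snd \<kappa> ` fst \<kappa>)) (\<lambda>\<tau>. u + \<tau> *\<^sub>R w)"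
    using seg by (auto intro!: continuous_intros)
  from continuous_map_compose[OF this continuous_map_chart_inv[OF \<kappa>]]
  have cont: "continuous_map (top_of_set {0..1}) (mtop M) \<gamma>" by (simp add: o_def \<gamma>_def[abs_def])
  have "C1_curve_on M \<gamma> 0 1"
    unfolding C1_curve_on_def
  proof (intro exI[of _ "\<lambda>\<tau> \<kappa>'. trans_deriv \<kappa> \<kappa>' (\<gamma> \<tau>) w"] ballI conjI impI)
    fix \<kappa>' \<tau> assume "\<kappa>' \<in> atlas M" "\<tau> \<in> {0..1}" "\<gamma> \<tau> \<in> fst \<kappa>'"
    then show "((snd \<kappa>' \<circ> \<gamma>) has_vector_derivative trans_deriv \<kappa> \<kappa>' (\<gamma> \<tau>) w) (at \<tau> within {0..1})"
      using der[of \<tau> \<kappa>'] by (simp add: charts_at_def has_vector_derivative_at_within)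
  next
    fix \<kappa>' assume \<kappa>': "\<kappa>' \<in> atlas M"
    obtain f' where
      f': "\<And>u. u \<in> snd \<kappa> ` (fst \<kappa> \<inter> fst \<kappa>') \<Longrightarrow> ((snd \<kappa>' \<circ> chart_inv \<kappa>) has_derivative f' u) (at u)"
      and f'_cont: "\<And>v. continuous_on (snd \<kappa> ` (fst \<kappa> \<inter> fst \<kappa>')) (\<lambda>u. f' u v)"
      using transition_C1[OF \<kappa> \<kappa>'] by metis
    let ?T = "{t \<in> {0..1}. \<gamma> t \<in> fst \<kappa>'}"
    have mem: "u + t *\<^sub>R w \<in> snd \<kappa> ` (fst \<kappa> \<inter> fst \<kappa>')" if "t \<in> ?T" for t
      using \<gamma>\<kappa>[of t] that charts_atD by (metis (no_types, lifting) IntI imageI mem_Collect_eq)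
    have eq: "trans_deriv \<kappa> \<kappa>' (\<gamma> t) w = f' (u + t *\<^sub>R w) w" if "t \<in> ?T" for t
      using frechet_derivative_at[OF f'[OF mem[OF that]]] \<gamma>\<kappa>(2)[of t] that by (simp add: trans_deriv_def)
    have "continuous_on ?T (\<lambda>t. f' (u + t *\<^sub>R w) w)"
    proof (rule continuous_on_compose2[OF f'_cont])
      show "continuous_on ?T (\<lambda>t. u + t *\<^sub>R w)" by (intro continuous_intros)
    qed (use mem in blast)
    then show "continuous_on ?T (\<lambda>\<tau>. trans_deriv \<kappa> \<kappa>' (\<gamma> \<tau>) w)"
      by (rule continuous_on_eq) (rule eq[symmetric])
  qed
  then have pw: "piecewise_C1_curve M \<gamma> 0 1"
    unfolding piecewise_C1_curve_def using cont by (intro conjI exI[of _ "{0, 1}"]) auto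
  have int: "curve_derivative M \<gamma> t \<in> cone_interior M C (\<gamma> t)" if t: "0 \<le> t" "t < 1" for t
  proof -
    have "curve_derivative M \<gamma> t = coord_vector M \<kappa> (\<gamma> t) w"
    proof
      fix \<kappa>'
      have "vector_derivative (snd \<kappa>' \<circ> \<gamma>) (at_right t) = trans_deriv \<kappa> \<kappa>' (\<gamma> t) w"
        if "\<kappa>' \<in> charts_at M (\<gamma> t)"
        using der[OF _ that] t
        by (intro vector_derivative_within)
          (auto simp: trivial_limit_at_right_real intro: has_vector_derivative_at_within)
      then show "curve_derivative M \<gamma> t \<kappa>' = coord_vector M \<kappa> (\<gamma> t) w \<kappa>'"
        by (simp add: curve_derivative_def coord_vector_alt)
    qed
    then show ?thesis
      using coord_cone_interior_iff[OF \<gamma>\<kappa>(1)[of t]] w[of t] t by (simp add: \<gamma>_def)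
  qed
  moreover have "cone_interior M C q \<subseteq> C q" for q
    by (simp add: cone_interior_def interior_of_subset)
  ultimately have "strictly_conal_curve M C \<gamma> 0 1"
    using pw unfolding strictly_conal_curve_def conal_curve_def by auto
  then show ?thesis
    unfolding conal_ll_def by (intro exI[of _ \<gamma>] exI[of _ 0] exI[of _ 1]) (simp add: \<gamma>_def)
qed

end

section \<open>The flow sharpens the conal order\<close>

lemma Ck_on_const: "Ck_on k (\<lambda>x. c) S"
  by (induction k arbitrary: c) (auto intro!: exI[of _ "\<lambda>_ _. 0"])

lemma Ck_on_ident: "Ck_on k (\<lambda>x. x) S"
  by (cases k) (auto intro!: exI[of _ "\<lambda>_ v. v"] Ck_on_const)

lemma smooth_mfd_real: "smooth_mfd real_manifold"
proof
  have inv: "chart_inv (UNIV, id) = (id :: real \<Rightarrow> real)"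
    by (auto simp: chart_inv_def fun_eq_iff inv_into_f_eq)
  have "Ck_on k (id \<circ> id) (UNIV :: real set)" for k
    using Ck_on_ident[of k "UNIV :: real set"] by (simp add: id_def o_def)
  moreover obtain B :: "real set set" where B: "countable B" "topological_basis B"
    using ex_countable_basis by blast
  have "second_countable (euclidean :: real topology)"
    unfolding second_countable_def
  proof (intro exI[of _ B] conjI allI impI ballI)
    show "openin euclidean U" if "U \<in> B" for U
      using topological_basis_open[OF B(2) that] by simp
    show "\<exists>V\<in>B. x \<in> V \<and> V \<subseteq> U" if "openin euclidean U \<and> x \<in> U" for U x
    proof -
      have "open U" "x \<in> U" using that by auto
      then obtain V where "V \<in> B" "x \<in> V" "V \<subseteq> U" by (rule topological_basisE[OF B(2)])
      then show ?thesis by blast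
    qed
  qed (rule B(1))
  ultimately show "smooth_manifold real_manifold"
    by (simp add: smooth_manifold_def real_manifold_def is_chart_def smooth_on_def inv)
qed

locale homogeneous_flow = homogeneous_cone_mfd G L H M C
  for G :: "('g, 'b) monoid_scheme" and L :: "('g, 'e::euclidean_space) manifold" and H M
    and C :: "('g set, 'n::euclidean_space) cone_field" +
  fixes V :: "'g set \<Rightarrow> ('g set, 'n) tangent" and \<phi> :: "real \<Rightarrow> 'g set \<Rightarrow> 'g set"
  assumes flow: "flow_of M V \<phi>"
    and positive: "strongly_differentially_positive M C \<phi>"
begin

lemma flow_joint_C1: "Ck_map 1 (prod_manifold real_manifold M) M (\<lambda>(t, x). \<phi> t x)"
  using flow by (simp add: flow_of_def)

lemma flow_add: "x \<in> topspace (mtop M) \<Longrightarrow> \<phi> (s + t) x = \<phi> s (\<phi> t x)"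
  using flow by (simp add: flow_of_def)

lemma flow_zero: "x \<in> topspace (mtop M) \<Longrightarrow> \<phi> 0 x = x"
  using flow by (simp add: flow_of_def)

lemma continuous_map_flow_joint:
  "continuous_map (prod_topology euclidean (mtop M)) (mtop M) (\<lambda>(t, x). \<phi> t x)"
  using flow_joint_C1 by (simp add: Ck_map_def prod_manifold_def real_manifold_def)

lemma continuous_map_flow: "continuous_map (mtop M) (mtop M) (\<phi> r)"
proof -
  have "continuous_map (mtop M) (prod_topology euclidean (mtop M)) (\<lambda>x. (r, x))"
    by (intro continuous_map_pairedI) auto
  from continuous_map_compose[OF this continuous_map_flow_joint] show ?thesis by (simp add: o_def)
qed

lemma continuous_map_orbit:
  assumes "x \<in> topspace (mtop M)"
  shows "continuous_map euclidean (mtop M) (\<lambda>t. \<phi> t x)"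
proof -
  have "continuous_map euclidean (prod_topology euclidean (mtop M)) (\<lambda>t. (t, x))"
    using assms by (intro continuous_map_pairedI) auto
  from continuous_map_compose[OF this continuous_map_flow_joint] show ?thesis by (simp add: o_def)
qed

lemma flow_in_space: "x \<in> topspace (mtop M) \<Longrightarrow> \<phi> r x \<in> topspace (mtop M)"
  using continuous_map_image_subset_topspace[OF continuous_map_flow] by blast

lemma flow_inj:
  assumes "x \<in> topspace (mtop M)" "y \<in> topspace (mtop M)" "\<phi> r x = \<phi> r y"
  shows "x = y"
  using assms flow_add[of x "- r" r] flow_add[of y "- r" r] flow_zero by simp

lemma flow_positive_uniform:
  assumes r: "r > 0" and x0: "\<kappa>0 \<in> charts_at M x0" and p: "\<kappa> \<in> charts_at M (\<phi> r x0)"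
  obtains D W U where "openin (mtop M) W" "x0 \<in> W" "W \<subseteq> fst \<kappa>0"
    "openin (mtop M) U" "\<phi> r x0 \<in> U" "U \<subseteq> fst \<kappa>"
    "\<And>z. z \<in> W \<Longrightarrow> ((snd \<kappa> \<circ> \<phi> r \<circ> chart_inv \<kappa>0) has_derivative D z) (at (snd \<kappa>0 z))"
    "\<And>z v q. \<lbrakk>z \<in> W; v \<in> coord_cone C \<kappa>0 z; v \<noteq> 0; q \<in> U\<rbrakk> \<Longrightarrow> D z v \<in> interior (coord_cone C \<kappa> q)"
proof -
  define W0 where "W0 = {z \<in> fst \<kappa>0. \<phi> r z \<in> fst \<kappa>}"
  have at: "\<kappa>0 \<in> atlas M" "\<kappa> \<in> atlas M" and mem: "x0 \<in> fst \<kappa>0" "\<phi> r x0 \<in> fst \<kappa>"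
    using x0 p charts_atD by auto
  have x0top: "x0 \<in> topspace (mtop M)" using at mem chart_subset by blast
  have R: "(UNIV, id) \<in> atlas real_manifold" by (simp add: real_manifold_def)
  let ?f = "\<lambda>(t, x). \<phi> t x"
  obtain F' where
    F': "\<forall>a x. a \<in> fst (UNIV :: real set, id :: real \<Rightarrow> real) \<and> x \<in> fst \<kappa>0 \<and> ?f (a, x) \<in> fst \<kappa> \<longrightarrow>
      ((snd \<kappa> \<circ> (\<lambda>y. ?f (a, y)) \<circ> chart_inv \<kappa>0) has_derivative F' (a, x)) (at (snd \<kappa>0 x))"
    and cont: "\<forall>v. continuous_map (subtopology (prod_topology (mtop real_manifold) (mtop M))
        {z \<in> fst (UNIV :: real set, id :: real \<Rightarrow> real) \<times> fst \<kappa>0. ?f z \<in> fst \<kappa>}) euclidean (\<lambda>z. F' z v)"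
    using partial_derivative_C1[OF smooth_mfd_real smooth_mfd_axioms flow_joint_C1 R at]
    by (elim exE conjE) (rule that)
  have der: "((snd \<kappa> \<circ> \<phi> r \<circ> chart_inv \<kappa>0) has_derivative F' (r, z)) (at (snd \<kappa>0 z))" if "z \<in> W0" for z
    using F'[rule_format, of r z] that by (simp add: W0_def)
  have "openin (mtop M) (fst \<kappa>0 \<inter> {z \<in> topspace (mtop M). \<phi> r z \<in> fst \<kappa>})"
    using chart(1)[OF at(1)] openin_continuous_map_preimage[OF continuous_map_flow chart(1)[OF at(2)]]
    by (rule openin_Int)
  moreover have "fst \<kappa>0 \<inter> {z \<in> topspace (mtop M). \<phi> r z \<in> fst \<kappa>} = W0"
    using chart_subset[OF at(1)] by (auto simp: W0_def)
  ultimately have openW0: "openin (mtop M) W0" by simp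
  have contW0: "continuous_map (subtopology (mtop M) W0) euclidean (\<lambda>z. F' (r, z) v)" for v
  proof -
    have "continuous_map (mtop M) (prod_topology (mtop real_manifold) (mtop M)) (\<lambda>z. (r, z))"
      by (intro continuous_map_pairedI) (auto simp: real_manifold_def)
    then have "continuous_map (subtopology (mtop M) W0) (subtopology (prod_topology (mtop real_manifold) (mtop M))
        {z \<in> fst (UNIV :: real set, id :: real \<Rightarrow> real) \<times> fst \<kappa>0. ?f z \<in> fst \<kappa>}) (\<lambda>z. (r, z))"
      by (auto simp: continuous_map_in_subtopology W0_def intro: continuous_map_from_subtopology)
    from continuous_map_compose[OF this cont[rule_format]] show ?thesis by (simp add: o_def)
  qed
  have pos: "differential M M (\<phi> r) x0 ` (C x0 - {\<lambda>\<kappa>. 0}) \<subseteq> cone_interior M C (\<phi> r x0)"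
    using positive r x0top by (simp add: strongly_differentially_positive_def)
  have "x0 \<in> W0" using mem by (simp add: W0_def)
  then obtain W U where W: "openin (mtop M) W" "x0 \<in> W" "W \<subseteq> W0"
    "openin (mtop M) U" "\<phi> r x0 \<in> U" "U \<subseteq> fst \<kappa>"
    "\<And>z v q. \<lbrakk>z \<in> W; v \<in> coord_cone C \<kappa>0 z; v \<noteq> 0; q \<in> U; z \<in> fst \<kappa>0\<rbrakk> \<Longrightarrow> F' (r, z) v \<in> interior (coord_cone C \<kappa> q)"
    using strict_positivity_uniform[of \<kappa>0 x0 \<kappa> "\<phi> r" W0 "\<lambda>z. F' (r, z)", OF x0 p openW0 _ der contW0 pos] by metis
  show thesis
  proof (rule that[OF W(1,2) _ W(4-6)])
    show "W \<subseteq> fst \<kappa>0" using W(3) by (auto simp: W0_def)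
    then show "F' (r, z) v \<in> interior (coord_cone C \<kappa> q)"
      if "z \<in> W" "v \<in> coord_cone C \<kappa>0 z" "v \<noteq> 0" "q \<in> U" for z v q
      using W(7)[OF that] that by blast
    show "((snd \<kappa> \<circ> \<phi> r \<circ> chart_inv \<kappa>0) has_derivative F' (r, z)) (at (snd \<kappa>0 z))" if "z \<in> W" for z
      using der W(3) that by blast
  qed
qed

text \<open>On a short interval the curve \<open>\<phi> r \<circ> \<gamma>\<close>, read in a chart, has its nonzero derivatives in the
  interiors of all cones over a fixed neighbourhood \<open>U\<close>. So does then its increment \<open>w\<close>, unless the
  curve is constant, and the segment with direction \<open>w\<close> between the endpoints is strictly conal as
  long as it remains in \<open>U\<close>. The chart image of \<open>B\<close> is a ball inside that of \<open>U\<close>, hence convex, which ensures this.\<close>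

lemma flow_conal_curve_local:
  assumes conal: "conal_curve M C \<gamma> t0 t1" and r: "r > 0" and s: "s \<in> {t0..t1}"
  shows "\<exists>d>0. \<forall>a b. a \<le> s \<and> s \<le> b \<and> b - a < d \<longrightarrow> {a..b} \<subseteq> {t0..t1} \<longrightarrow>
    (\<forall>t\<in>{a..b}. \<phi> r (\<gamma> t) = \<phi> r (\<gamma> a)) \<or> conal_ll M C (\<phi> r (\<gamma> a)) (\<phi> r (\<gamma> b))"
proof -
  let ?p = "\<phi> r (\<gamma> s)"
  have s_top: "\<gamma> s \<in> topspace (mtop M)" using conal_curve_in_space[OF conal s] .
  obtain \<kappa>0 \<kappa> where \<kappa>0: "\<kappa>0 \<in> charts_at M (\<gamma> s)" and \<kappa>: "\<kappa> \<in> charts_at M ?p"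
    using ex_chart s_top flow_in_space by meson
  have at: "\<kappa>0 \<in> atlas M" "\<kappa> \<in> atlas M" and mem: "\<gamma> s \<in> fst \<kappa>0" "?p \<in> fst \<kappa>"
    using \<kappa>0 \<kappa> charts_atD by auto
  obtain D W U where W: "openin (mtop M) W" "\<gamma> s \<in> W" "W \<subseteq> fst \<kappa>0"
    and U: "openin (mtop M) U" "?p \<in> U" "U \<subseteq> fst \<kappa>"
    and D: "\<And>z. z \<in> W \<Longrightarrow> ((snd \<kappa> \<circ> \<phi> r \<circ> chart_inv \<kappa>0) has_derivative D z) (at (snd \<kappa>0 z))"
    and pos: "\<And>z v q. \<lbrakk>z \<in> W; v \<in> coord_cone C \<kappa>0 z; v \<noteq> 0; q \<in> U\<rbrakk> \<Longrightarrow> D z v \<in> interior (coord_cone C \<kappa> q)"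
    using flow_positive_uniform[OF r \<kappa>0 \<kappa>] by metis
  obtain \<rho> where \<rho>: "\<rho> > 0" "ball (snd \<kappa> ?p) \<rho> \<subseteq> snd \<kappa> ` U"
    using open_chart_image[OF at(2) U(1,3)] U(2) open_contains_ball by (metis imageI)
  define B where "B = {q \<in> fst \<kappa>. snd \<kappa> q \<in> ball (snd \<kappa> ?p) \<rho>}"
  have B: "openin (mtop M) B" "?p \<in> B"
    using openin_chart_preimage[OF at(2) open_ball, of "snd \<kappa> ?p" \<rho>] mem \<rho>(1)
    by (simp_all only: B_def mem_Collect_eq centre_in_ball simp_thms)
  have cont\<gamma>: "continuous_map (top_of_set {t0..t1}) (mtop M) \<gamma>" using conal_curveD(3)[OF conal] .
  have cont\<sigma>: "continuous_map (top_of_set {t0..t1}) (mtop M) (\<phi> r \<circ> \<gamma>)"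
    using continuous_map_compose[OF cont\<gamma> continuous_map_flow] .
  have "openin (top_of_set {t0..t1}) ({t \<in> {t0..t1}. \<gamma> t \<in> W} \<inter> {t \<in> {t0..t1}. (\<phi> r \<circ> \<gamma>) t \<in> B})"
    using openin_continuous_map_preimage[OF cont\<gamma> W(1)] openin_continuous_map_preimage[OF cont\<sigma> B(1)]
    by (intro openin_Int) auto
  moreover have "s \<in> {t \<in> {t0..t1}. \<gamma> t \<in> W} \<inter> {t \<in> {t0..t1}. (\<phi> r \<circ> \<gamma>) t \<in> B}"
    using s W B by simp
  ultimately obtain d where d: "d > 0"
    "ball s d \<inter> {t0..t1} \<subseteq> {t \<in> {t0..t1}. \<gamma> t \<in> W} \<inter> {t \<in> {t0..t1}. (\<phi> r \<circ> \<gamma>) t \<in> B}"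
    unfolding openin_contains_ball by blast
  obtain P where P: "finite P"
    "\<And>t \<kappa>. \<lbrakk>t \<in> {t0<..<t1} - P; \<kappa> \<in> charts_at M (\<gamma> t)\<rbrakk> \<Longrightarrow>
       \<exists>d\<in>coord_cone C \<kappa> (\<gamma> t). ((snd \<kappa> \<circ> \<gamma>) has_vector_derivative d) (at t)"
    using conal_curve_chart_derivative[OF conal] by metis
  have "(\<forall>t\<in>{a..b}. \<phi> r (\<gamma> t) = \<phi> r (\<gamma> a)) \<or> conal_ll M C (\<phi> r (\<gamma> a)) (\<phi> r (\<gamma> b))"
    if ab: "a \<le> s" "s \<le> b" "b - a < d" "{a..b} \<subseteq> {t0..t1}" for a b
  proof -
    have "{a..b} \<subseteq> ball s d \<inter> {t0..t1}" using ab by (auto simp: dist_real_def)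
    then have in_WB: "\<gamma> t \<in> W" "\<phi> r (\<gamma> t) \<in> B" if "t \<in> {a..b}" for t
      using d(2) that by fastforce+
    define \<sigma> where "\<sigma> t = snd \<kappa> (\<phi> r (\<gamma> t))" for t
    have inv\<sigma>: "chart_inv \<kappa> (\<sigma> t) = \<phi> r (\<gamma> t)" if "t \<in> {a..b}" for t
      using in_WB[OF that] at by (simp add: \<sigma>_def B_def)
    have \<sigma>_ball: "\<sigma> t \<in> ball (snd \<kappa> ?p) \<rho>" if "t \<in> {a..b}" for t
      using in_WB[OF that] by (simp add: \<sigma>_def B_def)
    have "continuous_map (top_of_set {a..b}) (subtopology (mtop M) (fst \<kappa>)) (\<phi> r \<circ> \<gamma>)"
      using continuous_map_from_subtopology_mono[OF cont\<sigma> ab(4)] in_WB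
      by (auto simp: continuous_map_in_subtopology B_def)
    from continuous_map_compose[OF this continuous_map_chart[OF at(2)]]
    have \<sigma>_cont: "continuous_on {a..b} \<sigma>" by (simp add: o_def \<sigma>_def[abs_def])
    have \<sigma>_der: "\<exists>e. (\<sigma> has_vector_derivative e) (at t) \<and> (e = 0 \<or> (\<forall>q\<in>U. e \<in> interior (coord_cone C \<kappa> q)))"
      if t: "t \<in> {a<..<b} - P" for t
    proof -
      have "a \<in> {t0..t1}" "b \<in> {t0..t1}" using ab by auto
      then have tab: "t \<in> {a..b}" and "t \<in> {t0<..<t1} - P"
        using t by auto
      moreover have \<kappa>0t: "\<kappa>0 \<in> charts_at M (\<gamma> t)" using in_WB[OF tab] W(3) at by (auto simp: charts_at_def)
      ultimately obtain e where e: "e \<in> coord_cone C \<kappa>0 (\<gamma> t)" "((snd \<kappa>0 \<circ> \<gamma>) has_vector_derivative e) (at t)"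
        using P(2) by blast
      have "((snd \<kappa> \<circ> \<phi> r \<circ> chart_inv \<kappa>0) has_derivative D (\<gamma> t)) (at ((snd \<kappa>0 \<circ> \<gamma>) t))"
        using D in_WB[OF tab] by simp
      from vector_derivative_diff_chain_within[OF e(2) has_derivative_at_withinI[OF this]]
      have "((snd \<kappa> \<circ> \<phi> r \<circ> chart_inv \<kappa>0) \<circ> (snd \<kappa>0 \<circ> \<gamma>) has_vector_derivative D (\<gamma> t) e) (at t)" .
      then have "(\<sigma> has_vector_derivative D (\<gamma> t) e) (at t)"
      proof (rule has_vector_derivative_transform_within_open)
        show "((snd \<kappa> \<circ> \<phi> r \<circ> chart_inv \<kappa>0) \<circ> (snd \<kappa>0 \<circ> \<gamma>)) t' = \<sigma> t'" if "t' \<in> {a<..<b}" for t'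
          using in_WB[of t'] that W(3) at(1) by (auto simp: \<sigma>_def)
      qed (use t in auto)
      moreover have "D (\<gamma> t) e = 0 \<or> (\<forall>q\<in>U. D (\<gamma> t) e \<in> interior (coord_cone C \<kappa> q))"
      proof (cases "e = 0")
        case True
        then show ?thesis using linear_0[OF has_derivative_linear[OF D[OF in_WB(1)[OF tab]]]] by simp
      next
        case False
        then show ?thesis using pos in_WB(1)[OF tab] e(1) by blast
      qed
      ultimately show ?thesis by blast
    qed
    show ?thesis
    proof (cases "\<forall>t\<in>{a..b}. \<sigma> t = \<sigma> a")
      case True
      have "\<phi> r (\<gamma> t) = \<phi> r (\<gamma> a)" if "t \<in> {a..b}" for t
      proof -
        have "\<sigma> t = \<sigma> a" using True that by (rule bspec)
        moreover have "a \<in> {a..b}" using ab by simp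
        ultimately show ?thesis using inv\<sigma>[OF that] inv\<sigma>[of a] by simp
      qed
      then show ?thesis by blast
    next
      case False
      define w where "w = \<sigma> b - \<sigma> a"
      have w: "w \<in> interior (coord_cone C \<kappa> q)" if q: "q \<in> U" for q
      proof -
        have \<kappa>q: "\<kappa> \<in> charts_at M q" using q U(3) at by (auto simp: charts_at_def)
        have "(\<forall>t\<in>{a..b}. \<sigma> t = \<sigma> a) \<or> \<sigma> b - \<sigma> a \<in> interior (coord_cone C \<kappa> q)"
        proof (rule increment_in_convex_cone[OF _ _ _ _ \<sigma>_cont P(1)])
          show "convex (interior (coord_cone C \<kappa> q))"
            using coord_cone_convex[OF \<kappa>q] convex_interior by blast
          show "\<exists>e. (\<sigma> has_vector_derivative e) (at t) \<and> (e = 0 \<or> e \<in> interior (coord_cone C \<kappa> q))"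
            if "t \<in> {a<..<b} - P" for t
            using \<sigma>_der[OF that] q by blast
        qed (use ab coord_cone_interior_scale[OF \<kappa>q] in auto)
        then show ?thesis using False by (simp add: w_def)
      qed
      have in_U: "\<sigma> a + \<tau> *\<^sub>R w \<in> snd \<kappa> ` U" if "\<tau> \<in> {0..1}" for \<tau>
      proof -
        have "(1 - \<tau>) *\<^sub>R \<sigma> a + \<tau> *\<^sub>R \<sigma> b \<in> ball (snd \<kappa> ?p) \<rho>"
          using \<sigma>_ball[of a] \<sigma>_ball[of b] ab that by (intro convexD[OF convex_ball]) auto
        moreover have "(1 - \<tau>) *\<^sub>R \<sigma> a + \<tau> *\<^sub>R \<sigma> b = \<sigma> a + \<tau> *\<^sub>R w"
          by (simp add: w_def algebra_simps)
        ultimately show ?thesis using \<rho>(2) by auto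
      qed
      have "conal_ll M C (chart_inv \<kappa> (\<sigma> a)) (chart_inv \<kappa> (\<sigma> a + w))"
      proof (rule chart_segment_conal_ll[OF at(2)])
        fix \<tau> :: real assume \<tau>: "\<tau> \<in> {0..1}"
        show "\<sigma> a + \<tau> *\<^sub>R w \<in> snd \<kappa> ` fst \<kappa>" using in_U[OF \<tau>] U(3) by blast
        have "chart_inv \<kappa> (\<sigma> a + \<tau> *\<^sub>R w) \<in> U"
        proof -
          obtain q where "q \<in> U" "\<sigma> a + \<tau> *\<^sub>R w = snd \<kappa> q" using in_U[OF \<tau>] by blast
          then show ?thesis using U(3) at(2) by auto
        qed
        then show "w \<in> interior (coord_cone C \<kappa> (chart_inv \<kappa> (\<sigma> a + \<tau> *\<^sub>R w)))" by (rule w)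
      qed
      moreover have "\<sigma> a + w = \<sigma> b" by (simp add: w_def)
      ultimately show ?thesis using inv\<sigma>[of a] inv\<sigma>[of b] ab by simp
    qed
  qed
  then show ?thesis using d(1) by blast
qed

text \<open>The alternative has to be \<open>constant or \<lless>\<close> rather than \<open>equal endpoints or \<lless>\<close>, since there may be
  closed conal curves. In this form a strictly conal \<open>\<gamma>\<close> always falls under the second case.\<close>

lemma flow_conal_curve:
  assumes conal: "conal_curve M C \<gamma> t0 t1" and r: "r > 0"
  shows "(\<forall>t\<in>{t0..t1}. \<phi> r (\<gamma> t) = \<phi> r (\<gamma> t0)) \<or> conal_ll M C (\<phi> r (\<gamma> t0)) (\<phi> r (\<gamma> t1))"
proof -
  \<comment> \<open>The name \<open>I\<close> keeps the domain fixed while the bisection varies the endpoints.\<close>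
  define I where "I = {t0..t1}"
  have "t0 \<le> t1" using conal_curveD(1)[OF conal] by simp
  then have "{t0..t1} \<subseteq> I \<longrightarrow> (\<forall>t\<in>{t0..t1}. \<phi> r (\<gamma> t) = \<phi> r (\<gamma> t0)) \<or> conal_ll M C (\<phi> r (\<gamma> t0)) (\<phi> r (\<gamma> t1))"
  proof (induction rule: Bolzano)
    case (trans a b c)
    show ?case
    proof
      assume sub: "{a..c} \<subseteq> I"
      then have "{a..b} \<subseteq> I" "{b..c} \<subseteq> I" using trans(3,4) by auto
      then have ab: "(\<forall>t\<in>{a..b}. \<phi> r (\<gamma> t) = \<phi> r (\<gamma> a)) \<or> conal_ll M C (\<phi> r (\<gamma> a)) (\<phi> r (\<gamma> b))"
        and bc: "(\<forall>t\<in>{b..c}. \<phi> r (\<gamma> t) = \<phi> r (\<gamma> b)) \<or> conal_ll M C (\<phi> r (\<gamma> b)) (\<phi> r (\<gamma> c))"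
        using trans(1,2) by blast+
      have b: "b \<in> {a..b}" and c: "c \<in> {b..c}" using trans(3,4) by auto
      show "(\<forall>t\<in>{a..c}. \<phi> r (\<gamma> t) = \<phi> r (\<gamma> a)) \<or> conal_ll M C (\<phi> r (\<gamma> a)) (\<phi> r (\<gamma> c))"
        using ab
      proof
        assume const: "\<forall>t\<in>{a..b}. \<phi> r (\<gamma> t) = \<phi> r (\<gamma> a)"
        then have eq: "\<phi> r (\<gamma> b) = \<phi> r (\<gamma> a)" using b by blast
        show ?thesis
          using bc
        proof
          assume const': "\<forall>t\<in>{b..c}. \<phi> r (\<gamma> t) = \<phi> r (\<gamma> b)"
          have "\<phi> r (\<gamma> t) = \<phi> r (\<gamma> a)" if "t \<in> {a..c}" for t
          proof (cases "t \<le> b")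
            case True
            then show ?thesis using bspec[OF const, of t] that by simp
          next
            case False
            then show ?thesis using bspec[OF const', of t] eq that by simp
          qed
          then show ?thesis by blast
        qed (use eq in simp)
      next
        assume ll: "conal_ll M C (\<phi> r (\<gamma> a)) (\<phi> r (\<gamma> b))"
        show ?thesis
          using bc
        proof
          assume "\<forall>t\<in>{b..c}. \<phi> r (\<gamma> t) = \<phi> r (\<gamma> b)"
          then have "\<phi> r (\<gamma> c) = \<phi> r (\<gamma> b)" using c by blast
          then show ?thesis using ll by simp
        qed (use conal_ll_trans[OF ll] in blast)
      qed
    qed
  next
    case (local s)
    then show ?case using flow_conal_curve_local[OF conal r, of s] by (simp add: I_def)
  qed
  then show ?thesis by (simp add: I_def)
qed

lemma conal_less_flow:
  assumes "conal_less M C y z" "r > 0"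
  shows "conal_ll M C (\<phi> r y) (\<phi> r z)"
proof -
  obtain \<gamma> t0 t1 where \<gamma>: "conal_curve M C \<gamma> t0 t1" "\<gamma> t0 = y" "\<gamma> t1 = z" and ne: "y \<noteq> z"
    using assms(1) by (auto simp: conal_less_def conal_le_def)
  have "t0 < t1" using conal_curveD(1)[OF \<gamma>(1)] .
  then have "y \<in> topspace (mtop M)" "z \<in> topspace (mtop M)"
    using conal_curve_in_space[OF \<gamma>(1), of t0] conal_curve_in_space[OF \<gamma>(1), of t1] \<gamma>(2,3) by auto
  then have "\<phi> r z \<noteq> \<phi> r y" using flow_inj[of z y r] ne by blast
  moreover have "t1 \<in> {t0..t1}" using \<open>t0 < t1\<close> by simp
  ultimately show ?thesis using flow_conal_curve[OF \<gamma>(1) assms(2)] unfolding \<gamma>(2,3)[symmetric] by blast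
qed

lemma conal_ll_flow:
  assumes ll: "conal_ll M C y z" and r: "r \<ge> 0"
  shows "conal_ll M C (\<phi> r y) (\<phi> r z)"
proof -
  obtain \<gamma> t0 t1 where \<gamma>: "strictly_conal_curve M C \<gamma> t0 t1" "\<gamma> t0 = y" "\<gamma> t1 = z"
    using ll by (auto simp: conal_ll_def)
  note con = strictly_conal_curveD[OF \<gamma>(1)]
  have lt: "t0 < t1" using conal_curveD(1)[OF con] .
  have top: "\<gamma> t \<in> topspace (mtop M)" if "t \<in> {t0..t1}" for t using conal_curve_in_space[OF con that] .
  show ?thesis
  proof (cases "r = 0")
    case True
    then show ?thesis using ll flow_zero top[of t0] top[of t1] lt \<gamma> by simp
  next
    case False
    obtain t where t: "t \<in> {t0..t1}" "\<gamma> t \<noteq> \<gamma> t0" using strictly_conal_curve_not_constant[OF \<gamma>(1)] by blast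
    then have "\<phi> r (\<gamma> t) \<noteq> \<phi> r (\<gamma> t0)" using flow_inj[OF top[of t] top[of t0], of r] lt by auto
    moreover have "r > 0" using False r by simp
    ultimately show ?thesis using flow_conal_curve[OF con, of r] t(1) unfolding \<gamma>(2,3)[symmetric] by blast
  qed
qed

end

section \<open>Large time differences and limit points\<close>

text \<open>A large \<open>s\<close> is a sum of \<open>n = \<lfloor>s / T\<rfloor>\<close> copies of \<open>s / n\<close>, which differs from \<open>T\<close> by less than \<open>T / n\<close>.\<close>

lemma eventually_all_of_additive:
  fixes T \<epsilon> :: real
  assumes T: "T > 0" and \<epsilon>: "\<epsilon> > 0"
    and near: "\<And>s. \<bar>s - T\<bar> < \<epsilon> \<Longrightarrow> R s"
    and add: "\<And>s s'. R s \<Longrightarrow> R s' \<Longrightarrow> R (s + s')"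
  shows "\<exists>N. \<forall>s\<ge>N. R s"
proof (intro exI allI impI)
  fix s assume s: "s \<ge> T * (T / \<epsilon> + 2)"
  define n where "n = nat \<lfloor>s / T\<rfloor>"
  have sT: "s / T \<ge> T / \<epsilon> + 2" using s T by (simp add: field_simps)
  then have "s / T \<ge> 0" using T \<epsilon> by (smt (verit) divide_pos_pos)
  then have n: "real n \<le> s / T" "s / T < real n + 1" by (simp_all add: n_def)
  then have n_big: "real n > T / \<epsilon> + 1" using sT by linarith
  then have n_pos: "real n > 0" using T \<epsilon> by (smt (verit) divide_pos_pos)
  have "real n * T \<le> s" "s < real n * T + T" using n T by (simp_all add: field_simps)
  then have "n * T / n \<le> s / n" "s / n < (n * T + T) / n"
    using n_pos by (intro divide_right_mono divide_strict_right_mono; simp)+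
  then have "0 \<le> s / n - T" "s / n - T < T / n" using n_pos by (simp_all add: add_divide_distrib)
  moreover have "T / n < \<epsilon>" using n_big \<epsilon> T n_pos by (simp add: field_simps)
  ultimately have v: "R (s / n)" by (intro near) auto
  have "R (real (Suc m) * (s / n))" for m
  proof (induction m)
    case (Suc m)
    have "R (real (Suc m) * (s / n) + s / n)" using add[OF Suc v] .
    moreover have "real (Suc m) * v + v = real (Suc (Suc m)) * v" for v
      by (simp add: algebra_simps)
    ultimately show ?case by (simp only:)
  qed (use v in simp)
  from this[of "n - 1"] show "R s" using n_pos by simp
qed

context smooth_mfd
begin

lemma limitin_shrinking_chart_balls:
  assumes \<kappa>: "\<kappa> \<in> charts_at M y"
    and z: "\<And>n. z n \<in> {q \<in> fst \<kappa>. snd \<kappa> q \<in> ball (snd \<kappa> y) (1 / Suc n)}"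
  shows "limitin (mtop M) z y sequentially"
  unfolding limitin_def
proof (intro conjI allI impI)
  have at: "\<kappa> \<in> atlas M" and y: "y \<in> fst \<kappa>" using \<kappa> charts_atD by auto
  show "y \<in> topspace (mtop M)" using at y chart_subset by blast
  fix U assume U: "openin (mtop M) U \<and> y \<in> U"
  have "openin (mtop M) (U \<inter> fst \<kappa>)" using U chart(1)[OF at] by blast
  then have "open (snd \<kappa> ` (U \<inter> fst \<kappa>))" using open_chart_image[OF at] by blast
  moreover have "snd \<kappa> y \<in> snd \<kappa> ` (U \<inter> fst \<kappa>)" using U y by blast
  ultimately obtain r where r: "r > 0" "ball (snd \<kappa> y) r \<subseteq> snd \<kappa> ` (U \<inter> fst \<kappa>)"
    using open_contains_ball by blast
  obtain N where N: "N > 0" "1 / real N < r" using real_arch_inverse[of r] r(1) by (auto simp: inverse_eq_divide)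
  have "z n \<in> U" if n: "n \<ge> N" for n
  proof -
    have "1 / Suc n \<le> 1 / N" using n N(1) by (intro divide_left_mono) auto
    then have "snd \<kappa> (z n) \<in> ball (snd \<kappa> y) r" using z[of n] N(2) by auto
    then obtain q where q: "q \<in> U" "q \<in> fst \<kappa>" "snd \<kappa> (z n) = snd \<kappa> q" using r(2) by blast
    then have "z n = q" using z[of n] inj_onD[OF chart_inj[OF at]] by blast
    then show ?thesis using q by simp
  qed
  then show "eventually (\<lambda>n. z n \<in> U) sequentially" by (auto simp: eventually_sequentially)
qed

end

lemma inner_continuous_atD:
  assumes "inner_continuous_at X I p" "compactin X K" "K \<subseteq> I p"
  obtains U where "openin X U" "p \<in> U" "\<And>q. q \<in> U \<Longrightarrow> K \<subseteq> I q"
proof -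
  have "\<exists>U. openin X U \<and> p \<in> U \<and> (\<forall>q\<in>U. K \<subseteq> I q)"
    using assms by (simp add: inner_continuous_at_def)
  then show thesis using that by auto
qed

context homogeneous_flow
begin

lemma omega_limit_visits:
  assumes "y \<in> omega_limit (mtop M) \<phi> x" "openin (mtop M) B" "y \<in> B"
  shows "\<exists>t\<ge>s. \<phi> t x \<in> B"
proof -
  have "y \<in> mtop M closure_of (\<Union>t\<in>{max s 0..}. {\<phi> t x})"
    using assms(1) by (auto simp: omega_limit_def)
  then obtain q where "q \<in> (\<Union>t\<in>{max s 0..}. {\<phi> t x})" "q \<in> B"
    using assms(2,3) unfolding in_closure_of by blast
  then show ?thesis by auto
qed

lemma omega_limit_in_space: "y \<in> omega_limit (mtop M) \<phi> x \<Longrightarrow> y \<in> topspace (mtop M)"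
  using closure_of_subset_topspace by (fastforce simp: omega_limit_def)

text \<open>Any two points of \<open>\<omega>(x)\<close> are approached along times \<open>t1 n\<close> and \<open>t2 n\<close> with \<open>t2 n - t1 n \<ge> N\<close>, whichever
  of the two comes first. Here \<open>Q\<close> and \<open>R\<close> stand for \<open>\<lless>\<close> and \<open>\<le>\<close>, or for their converses.\<close>

lemma omega_limit_related:
  assumes rel: "\<And>s t. s \<ge> N \<Longrightarrow> t \<ge> 1 \<Longrightarrow> Q (\<phi> t x) (\<phi> (t + s) x)"
    and closed: "\<And>xs ys a b. limitin (mtop M) xs a sequentially \<Longrightarrow> limitin (mtop M) ys b sequentially \<Longrightarrow>
      (\<And>n::nat. Q (xs n) (ys n)) \<Longrightarrow> R a b"
    and y: "y1 \<in> omega_limit (mtop M) \<phi> x" "y2 \<in> omega_limit (mtop M) \<phi> x"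
  shows "R y1 y2"
proof -
  obtain \<kappa>1 \<kappa>2 where \<kappa>: "\<kappa>1 \<in> charts_at M y1" "\<kappa>2 \<in> charts_at M y2"
    using ex_chart omega_limit_in_space y by meson
  define B1 where "B1 n = {q \<in> fst \<kappa>1. snd \<kappa>1 q \<in> ball (snd \<kappa>1 y1) (1 / Suc n)}" for n
  define B2 where "B2 n = {q \<in> fst \<kappa>2. snd \<kappa>2 q \<in> ball (snd \<kappa>2 y2) (1 / Suc n)}" for n
  have "openin (mtop M) (B1 n)" "openin (mtop M) (B2 n)" for n
    unfolding B1_def B2_def using \<kappa> charts_atD(1) by (intro openin_chart_preimage open_ball; blast)+
  moreover have "y1 \<in> B1 n" "y2 \<in> B2 n" for n
    using \<kappa> charts_atD(2) by (simp_all add: B1_def B2_def)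
  ultimately have visits: "\<exists>t\<ge>s. \<phi> t x \<in> B1 n" "\<exists>t\<ge>s. \<phi> t x \<in> B2 n" for s n
    using omega_limit_visits y by metis+
  have "\<exists>t1 t2. t1 \<ge> 1 \<and> t2 - t1 \<ge> N \<and> \<phi> t1 x \<in> B1 n \<and> \<phi> t2 x \<in> B2 n" for n
  proof -
    obtain t1 where t1: "t1 \<ge> 1" "\<phi> t1 x \<in> B1 n" using visits(1) by blast
    obtain t2 where "t2 \<ge> t1 + N" "\<phi> t2 x \<in> B2 n" using visits(2) by blast
    with t1 show ?thesis by (intro exI[of _ t1] exI[of _ t2]) auto
  qed
  then obtain t1 t2 where t: "\<And>n. t1 n \<ge> 1" "\<And>n. t2 n - t1 n \<ge> N" "\<And>n. \<phi> (t1 n) x \<in> B1 n" "\<And>n. \<phi> (t2 n) x \<in> B2 n"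
    by metis
  have "Q (\<phi> (t1 n) x) (\<phi> (t2 n) x)" for n
    using rel[OF t(2) t(1), of n n] by simp
  moreover have "limitin (mtop M) (\<lambda>n. \<phi> (t1 n) x) y1 sequentially"
    by (rule limitin_shrinking_chart_balls[OF \<kappa>(1)]) (rule t(3)[unfolded B1_def])
  moreover have "limitin (mtop M) (\<lambda>n. \<phi> (t2 n) x) y2 sequentially"
    by (rule limitin_shrinking_chart_balls[OF \<kappa>(2)]) (rule t(4)[unfolded B2_def])
  ultimately show ?thesis using closed by blast
qed

text \<open>The times \<open>s\<close> with \<open>Q (\<phi> t x) (\<phi> (t + s) x)\<close> for all \<open>t \<ge> 1\<close> contain a neighbourhood of \<open>T\<close>: the relation
  at \<open>t = 1\<close> is open in the second argument, and the flow propagates it to later \<open>t\<close>. Among the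
  nonnegative times they are closed under addition, by transitivity.\<close>

lemma related_for_late_times:
  assumes x: "x \<in> topspace (mtop M)" and T: "T > 0"
    and trans: "\<And>a b c. Q a b \<Longrightarrow> Q b c \<Longrightarrow> Q a c"
    and push: "\<And>a b r. Q a b \<Longrightarrow> r \<ge> 0 \<Longrightarrow> Q (\<phi> r a) (\<phi> r b)"
    and U: "openin (mtop M) U" "\<phi> (1 + T) x \<in> U" "\<And>q. q \<in> U \<Longrightarrow> Q (\<phi> 1 x) q"
  shows "\<exists>N. \<forall>s\<ge>N. \<forall>t\<ge>1. Q (\<phi> t x) (\<phi> (t + s) x)"
proof -
  have "open {t. \<phi> t x \<in> U}"
    using openin_continuous_map_preimage[OF continuous_map_orbit[OF x] U(1)] by simp
  then obtain \<epsilon> where \<epsilon>: "\<epsilon> > 0" "ball (1 + T) \<epsilon> \<subseteq> {t. \<phi> t x \<in> U}"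
    using U(2) open_contains_ball by (metis mem_Collect_eq)
  define R where "R s \<longleftrightarrow> s \<ge> 0 \<and> (\<forall>t\<ge>1. Q (\<phi> t x) (\<phi> (t + s) x))" for s
  have "\<exists>N. \<forall>s\<ge>N. R s"
  proof (rule eventually_all_of_additive[OF T])
    show "min \<epsilon> T > 0" using \<epsilon>(1) T by simp
    fix s assume s: "\<bar>s - T\<bar> < min \<epsilon> T"
    then have "1 + s \<in> ball (1 + T) \<epsilon>" by (simp add: dist_real_def abs_minus_commute)
    then have Q1: "Q (\<phi> 1 x) (\<phi> (1 + s) x)" using \<epsilon>(2) U(3) by blast
    show "R s"
      unfolding R_def
    proof (intro conjI allI impI)
      have "\<bar>s - T\<bar> < T" using s by simp
      then show "s \<ge> 0" by linarith
      fix t :: real assume "t \<ge> 1"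
      then have "Q (\<phi> (t - 1) (\<phi> 1 x)) (\<phi> (t - 1) (\<phi> (1 + s) x))" by (intro push Q1) simp
      then show "Q (\<phi> t x) (\<phi> (t + s) x)" using flow_add[OF x, of "t - 1" 1] flow_add[OF x, of "t - 1" "1 + s"] by simp
    qed
  next
    fix s s' assume R: "R s" "R s'"
    show "R (s + s')"
      unfolding R_def
    proof (intro conjI allI impI)
      show "s + s' \<ge> 0" using R by (simp add: R_def)
      fix t :: real assume t: "t \<ge> 1"
      have "Q (\<phi> t x) (\<phi> (t + s) x)" "Q (\<phi> (t + s) x) (\<phi> (t + s + s') x)"
        using R t by (simp_all add: R_def)
      then show "Q (\<phi> t x) (\<phi> (t + (s + s')) x)" using trans by (simp add: add.assoc)
    qed
  qed
  then show ?thesis by (auto simp: R_def)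
qed

end

theorem proposition4p3:
  fixes G :: "('g, 'b) monoid_scheme"
    and L :: "('g, 'e::euclidean_space) manifold"
    and \<rho>G :: "('g, 'e) metric_tensor"
    and H :: "'g set"
    and M :: "('g set, 'n::euclidean_space) manifold"
    and \<rho> :: "('g set, 'n) metric_tensor"
    and C :: "('g set, 'n) cone_field"
    and V :: "'g set \<Rightarrow> ('g set, 'n) tangent"
    and \<phi> :: "real \<Rightarrow> 'g set \<Rightarrow> 'g set"
    and x :: "'g set"
  assumes "homogeneous_space G L H M"
    and "connected_space (mtop L)"
    and "left_invariant_metric G L \<rho>G"
    and "invariant_metric G M \<rho>"
    and "solid_cone_field M C"
    and "homogeneous_cone_field G M C"
    and "quasi_closed_order M C"
    and "continuous_set_map (mtop M) (chron_future M C)"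
    and "continuous_set_map (mtop M) (chron_past M C)"
    and "C1_vector_field M V"
    and "flow_of M V \<phi>"
    and "strongly_differentially_positive M C \<phi>"
    and "\<forall>z\<in>topspace (mtop M). compactin (mtop M) (mtop M closure_of (orbit_of \<phi> z))"
    and "x \<in> recurrent_points (mtop M) \<phi>"
    and "\<exists>T>0. conal_less M C x (\<phi> T x) \<or> conal_less M C (\<phi> T x) x"
  shows "ordered_set M C (omega_limit (mtop M) \<phi> x) \<and>
    (\<forall>y1\<in>omega_limit (mtop M) \<phi> x. \<forall>y2\<in>omega_limit (mtop M) \<phi> x.
       conal_le M C y1 y2 \<and> conal_le M C y2 y1)"
proof -
  interpret homogeneous_flow G L H M C V \<phi>
    using assms(1,5,6,11,12) by unfold_locales (simp_all add: solid_cone_field_def)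
  have x: "x \<in> topspace (mtop M)" using assms(14) by (simp add: recurrent_points_def)
  obtain T where T: "T > 0" "conal_less M C x (\<phi> T x) \<or> conal_less M C (\<phi> T x) x"
    using assms(15) by blast
  have flow_T: "\<phi> 1 (\<phi> T x) = \<phi> (1 + T) x" using flow_add[OF x] by simp
  have closed: "conal_le M C a b"
    if "limitin (mtop M) xs a sequentially" "limitin (mtop M) ys b sequentially"
      "\<And>n::nat. conal_ll M C (xs n) (ys n)" for xs ys a b
    using assms(7) that unfolding quasi_closed_order_def by blast
  let ?p = "\<phi> (1 + T) x"
  have p: "?p \<in> topspace (mtop M)" and x1: "compactin (mtop M) {\<phi> 1 x}"
    using flow_in_space[OF x] by simp_all
  have all_le: "conal_le M C y1 y2"
    if "y1 \<in> omega_limit (mtop M) \<phi> x" "y2 \<in> omega_limit (mtop M) \<phi> x" for y1 y2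
    using T(2)
  proof
    assume "conal_less M C x (\<phi> T x)"
    then have "conal_ll M C (\<phi> 1 x) ?p" using conal_less_flow[of x "\<phi> T x" 1] flow_T by simp
    then have sub: "{\<phi> 1 x} \<subseteq> chron_past M C ?p" by (simp add: chron_past_def)
    have inner: "inner_continuous_at (mtop M) (chron_past M C) ?p"
      using assms(9) p by (simp add: continuous_set_map_def)
    obtain U where U: "openin (mtop M) U" "?p \<in> U" "\<And>q. q \<in> U \<Longrightarrow> {\<phi> 1 x} \<subseteq> chron_past M C q"
      using inner_continuous_atD[OF inner x1 sub] by metis
    have "\<exists>N. \<forall>s\<ge>N. \<forall>t\<ge>1. conal_ll M C (\<phi> t x) (\<phi> (t + s) x)"
    proof (rule related_for_late_times[where Q = "conal_ll M C", OF x T(1) _ _ U(1,2)])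
      show "conal_ll M C a c" if "conal_ll M C a b" "conal_ll M C b c" for a b c
        using that by (rule conal_ll_trans)
      show "conal_ll M C (\<phi> 1 x) q" if "q \<in> U" for q
        using U(3)[OF that] by (simp add: chron_past_def)
    qed (rule conal_ll_flow)
    then obtain N where N: "\<And>s t. s \<ge> N \<Longrightarrow> t \<ge> 1 \<Longrightarrow> conal_ll M C (\<phi> t x) (\<phi> (t + s) x)" by blast
    show ?thesis
      by (rule omega_limit_related[where Q = "conal_ll M C", OF _ _ that]) (rule N closed; assumption)+
  next
    assume "conal_less M C (\<phi> T x) x"
    then have "conal_ll M C ?p (\<phi> 1 x)" using conal_less_flow[of "\<phi> T x" x 1] flow_T by simp
    then have sub: "{\<phi> 1 x} \<subseteq> chron_future M C ?p" by (simp add: chron_future_def)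
    have inner: "inner_continuous_at (mtop M) (chron_future M C) ?p"
      using assms(8) p by (simp add: continuous_set_map_def)
    obtain U where U: "openin (mtop M) U" "?p \<in> U" "\<And>q. q \<in> U \<Longrightarrow> {\<phi> 1 x} \<subseteq> chron_future M C q"
      using inner_continuous_atD[OF inner x1 sub] by metis
    have "\<exists>N. \<forall>s\<ge>N. \<forall>t\<ge>1. conal_ll M C (\<phi> (t + s) x) (\<phi> t x)"
    proof (rule related_for_late_times[where Q = "\<lambda>a b. conal_ll M C b a", OF x T(1) _ _ U(1,2)])
      show "conal_ll M C c a" if "conal_ll M C b a" "conal_ll M C c b" for a b c
        using that(2,1) by (rule conal_ll_trans)
      show "conal_ll M C q (\<phi> 1 x)" if "q \<in> U" for q
        using U(3)[OF that] by (simp add: chron_future_def)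
    qed (rule conal_ll_flow)
    then obtain N where N: "\<And>s t. s \<ge> N \<Longrightarrow> t \<ge> 1 \<Longrightarrow> conal_ll M C (\<phi> (t + s) x) (\<phi> t x)" by blast
    show ?thesis
      by (rule omega_limit_related[where Q = "\<lambda>a b. conal_ll M C b a" and R = "\<lambda>a b. conal_le M C b a",
            OF _ _ that(2,1)]) (rule N closed; assumption)+
  qed
  then show ?thesis unfolding ordered_set_def by blast
qed

end
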